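(* Let $d^B(\pi)$ denote the total degree of $\pi\in B_n$, i.e. the number of elements of $B_n$ that cover or are covered by $\pi$ in the strong Bruhat order. Then $\max\{d^B(\pi):\pi\in B_n\}=4(n-1)$ for $2\le n\le 5$, and $\max\{d^B(\pi):\pi\in B_n\}=\lfloor n^2/2\rfloor+n-1$ for $n\ge 5$.
   Context: $B_n$ is the group of signed permutations, i.e. permutations $\pi$ of $[-n,n]\setminus\{0\}$ with $\pi(-i)=-\pi(i)$, viewed as the Coxeter group of type $B_n$ with generators $s_0=t_{1,-1}$ and $s_i=t_{i,i+1}t_{-i,-(i+1)}$ ($t_{x,y}$ the transposition of $x,y$); the strong Bruhat order is the Bruhat order of this Coxeter group. (For $n=5$ both formulas give $16$.) *)

theory Defs
  imports "HOL-Combinatorics.Permutations"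
begin

definition signed_points :: "nat \<Rightarrow> int set" where
  "signed_points n = {- int n..int n} - {0}"

(* Permutations are extended by the identity outside the point set, as in the library
   predicate permutes, so that composition of functions is the group operation. *)
definition signed_perms :: "nat \<Rightarrow> (int \<Rightarrow> int) set" where
  "signed_perms n =
     {p. p permutes signed_points n \<and> (\<forall>i\<in>signed_points n. p (- i) = - p i)}"

definition simple_refl :: "nat \<Rightarrow> int \<Rightarrow> int" where
  "simple_refl i =
     (if i = 0 then transpose 1 (- 1)
      else transpose (int i) (int i + 1) \<circ> transpose (- int i) (- (int i + 1)))"

definition simple_refls :: "nat \<Rightarrow> (int \<Rightarrow> int) set" where
  "simple_refls n = simple_refl ` {0..<n}"

definition cox_length :: "nat \<Rightarrow> (int \<Rightarrow> int) \<Rightarrow> nat" where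
  "cox_length n w =
     (LEAST k. \<exists>ss. set ss \<subseteq> simple_refls n \<and> length ss = k \<and> foldr (\<circ>) ss id = w)"

definition reflections :: "nat \<Rightarrow> (int \<Rightarrow> int) set" where
  "reflections n = {w \<circ> s \<circ> inv w | w s. w \<in> signed_perms n \<and> s \<in> simple_refls n}"

definition bruhat_step :: "nat \<Rightarrow> (int \<Rightarrow> int) rel" where
  "bruhat_step n =
     {(u, v). u \<in> signed_perms n \<and> v \<in> signed_perms n \<and>
        (\<exists>t\<in>reflections n. v = u \<circ> t) \<and> cox_length n u < cox_length n v}"

definition bruhat_le :: "nat \<Rightarrow> (int \<Rightarrow> int) \<Rightarrow> (int \<Rightarrow> int) \<Rightarrow> bool" where
  "bruhat_le n u v \<longleftrightarrow> (u, v) \<in> (bruhat_step n)\<^sup>*"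

definition bruhat_less :: "nat \<Rightarrow> (int \<Rightarrow> int) \<Rightarrow> (int \<Rightarrow> int) \<Rightarrow> bool" where
  "bruhat_less n u v \<longleftrightarrow> bruhat_le n u v \<and> u \<noteq> v"

definition bruhat_covers :: "nat \<Rightarrow> (int \<Rightarrow> int) \<Rightarrow> (int \<Rightarrow> int) \<Rightarrow> bool" where
  "bruhat_covers n v u \<longleftrightarrow>
     bruhat_less n u v \<and>
     \<not> (\<exists>x\<in>signed_perms n. bruhat_less n u x \<and> bruhat_less n x v)"

definition total_degree :: "nat \<Rightarrow> (int \<Rightarrow> int) \<Rightarrow> nat" where
  "total_degree n p =
     card {q \<in> signed_perms n. bruhat_covers n q p \<or> bruhat_covers n p q}"

end

(* Write a signed permutation p as n points (i, |p i|), coloured by the sign of p i.  The covers of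
   p correspond to pairs (i, j) whose rectangle is empty and avoids the origin (except when
   i = -j), so the total degree counts loops (points minimal in the product order), at most one
   edge between points of equal colour and at most two between points of different colour.

   Upper bound: induction by deleting points, which only creates new edges.  Let R be the rightmost
   point.  If no point is doubly joined to R, then R has degree at most n.  Otherwise let q be the
   highest point doubly joined to R: the emptiness conditions force all but at most two other points
   to send at most two edges to {R, q}, so deleting R and q loses at most 2n.  This fails only if R
   is the bottom right corner; the argument is then repeated with the topmost point, and if that is
   the top left corner some third point has degree at most n.  The recursion is tight from n = 5 on,
   up to an averaging argument for n = 6; the cases n <= 5 are finite. *)

theory Submission
  imports Defs
begin

section \<open>Bicoloured point configurations\<close>

text \<open>The leading term floor(n^2/2) is 2 * floor(n^2/4), twice Mantel's bound for
  triangle-free graphs, and pair deletion is Mantel's argument: there the ends of an edge send at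
  most n - 2 edges to the other vertices; here the ends of a double edge send 2(n - 2), plus an
  excess of at most two that also absorbs their loops. With the double edge itself this is a loss of
  2n, exactly the growth of the formula from n - 2 to n. One extreme point alone is not enough,
  since it may be doubly joined to a whole block of the other colour. The extremal graph is complete
  bipartite with doubled edges on two blocks of nearly equal size, with a path inside each block and
  one loop.

  For small n a linear competitor wins: with decreasing heights and alternating colours, neighbours
  are doubly joined, points two apart are joined once and all points carry loops, which gives 2(n -
  1) + (n - 2) + n. It ties at n = 5 and exceeds the quadratic formula by one at n = 4, so the pair
  step from 4 to 6 overshoots by one.\<close>

definition btw :: "'a::linorder \<Rightarrow> 'a \<Rightarrow> 'a \<Rightarrow> bool" where
  "btw a b c \<longleftrightarrow> a < b \<and> b < c \<or> c < b \<and> b < a"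

text \<open>Points of the other colour cannot obstruct: their values have the opposite sign and lie
  outside the interval between the values at \<open>p\<close> and \<open>q\<close>.\<close>

definition box_free :: "('a \<Rightarrow> 'b::linorder) \<Rightarrow> ('a \<Rightarrow> 'c::linorder) \<Rightarrow> ('a \<Rightarrow> bool) \<Rightarrow> 'a set \<Rightarrow> 'a \<Rightarrow> 'a \<Rightarrow> bool" where
  "box_free X Y col V p q \<longleftrightarrow>
     (\<forall>r\<in>V. col r = col p \<longrightarrow> btw (X p) (X r) (X q) \<longrightarrow> \<not> btw (Y p) (Y r) (Y q))"

text \<open>For two points of different colour the rectangle in question crosses a coordinate axis.
  Folded onto the positive quadrant, over the strip between the two heights, it reaches up to
  \<open>X p\<close> for points coloured like \<open>p\<close> and up to \<open>X q\<close> for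
  points coloured like \<open>q\<close>.\<close>

definition mixed_free :: "('a \<Rightarrow> 'b::linorder) \<Rightarrow> ('a \<Rightarrow> 'c::linorder) \<Rightarrow> ('a \<Rightarrow> bool) \<Rightarrow> 'a set \<Rightarrow> 'a \<Rightarrow> 'a \<Rightarrow> bool" where
  "mixed_free X Y col V p q \<longleftrightarrow>
     (\<forall>r\<in>V. btw (Y p) (Y r) (Y q) \<longrightarrow> (if col r = col p then X p < X r else X q < X r))"

text \<open>The two edges between points \<open>p\<close>, \<open>q\<close> of different colour stand for the reflections
  exchanging \<open>p\<close> with \<open>q\<close> and with \<open>- q\<close>; swapping the coordinates swaps the two conditions.\<close>

definition mult :: "('a \<Rightarrow> 'b::linorder) \<Rightarrow> ('a \<Rightarrow> 'c::linorder) \<Rightarrow> ('a \<Rightarrow> bool) \<Rightarrow> 'a set \<Rightarrow> 'a \<Rightarrow> 'a \<Rightarrow> nat" where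
  "mult X Y col V p q =
     (if col p = col q then of_bool (box_free X Y col V p q)
      else of_bool (mixed_free X Y col V p q) + of_bool (mixed_free Y X col V p q))"

definition loop :: "('a \<Rightarrow> 'b::linorder) \<Rightarrow> ('a \<Rightarrow> 'c::linorder) \<Rightarrow> 'a set \<Rightarrow> 'a \<Rightarrow> nat" where
  "loop X Y V p = of_bool (\<forall>r\<in>V. X r < X p \<longrightarrow> \<not> Y r < Y p)"

definition deg :: "('a \<Rightarrow> 'b::linorder) \<Rightarrow> ('a \<Rightarrow> 'c::linorder) \<Rightarrow> ('a \<Rightarrow> bool) \<Rightarrow> 'a set \<Rightarrow> 'a \<Rightarrow> nat" where
  "deg X Y col V p = loop X Y V p + (\<Sum>q\<in>V - {p}. mult X Y col V p q)"

text \<open>Twice the number of loops and edges: every loop enters once through \<open>deg\<close> and once more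
  explicitly.\<close>

definition weight :: "('a \<Rightarrow> 'b::linorder) \<Rightarrow> ('a \<Rightarrow> 'c::linorder) \<Rightarrow> ('a \<Rightarrow> bool) \<Rightarrow> 'a set \<Rightarrow> nat" where
  "weight X Y col V = (\<Sum>p\<in>V. deg X Y col V p + loop X Y V p)"

lemma btw_sym: "btw a b c \<longleftrightarrow> btw c b a"
  by (auto simp: btw_def)

lemma mult_sym: "mult X Y col V p q = mult X Y col V q p"
proof -
  have b: "box_free X Y col V p q \<longleftrightarrow> box_free X Y col V q p" if "col p = col q"
    unfolding box_free_def btw_sym[of "X q"] btw_sym[of "Y q"] using that by simp
  have m: "mixed_free f g col V p q \<longleftrightarrow> mixed_free f g col V q p" if "col p \<noteq> col q"
    for f :: "'a \<Rightarrow> 'e::linorder" and g :: "'a \<Rightarrow> 'f::linorder"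
    unfolding mixed_free_def btw_sym[of "g q"] using that by (cases "col p") auto
  show ?thesis
    using b m[of X Y] m[of Y X] by (cases "col p = col q") (simp_all add: mult_def)
qed

lemma box_free_swap: "box_free Y X col V p q = box_free X Y col V p q"
  unfolding box_free_def by blast

lemma mult_swap: "mult Y X col V p q = mult X Y col V p q"
  by (simp add: mult_def box_free_swap[of Y X] add.commute)

lemma loop_swap: "loop Y X V p = loop X Y V p"
  unfolding loop_def by (rule arg_cong[where f = of_bool]) blast

lemma deg_swap: "deg Y X col V p = deg X Y col V p"
  by (simp add: deg_def mult_swap[of Y X] loop_swap[of Y X])

lemma mult_le_2: "mult X Y col V p q \<le> 2"
  by (simp add: mult_def)

lemma mult_le_1: "col p = col q \<Longrightarrow> mult X Y col V p q \<le> 1"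
  by (simp add: mult_def)

lemma loop_le: "loop X Y V p \<le> 1"
  by (simp add: loop_def)

lemma mixed_free_mono: "V \<subseteq> W \<Longrightarrow> mixed_free X Y col W p q \<Longrightarrow> mixed_free X Y col V p q"
  unfolding mixed_free_def by blast

lemma box_free_mono: "V \<subseteq> W \<Longrightarrow> box_free X Y col W p q \<Longrightarrow> box_free X Y col V p q"
  unfolding box_free_def by blast

lemma mult_mono: "V \<subseteq> W \<Longrightarrow> mult X Y col W p q \<le> mult X Y col V p q"
  using mixed_free_mono[of V W X Y col p q] mixed_free_mono[of V W Y X col p q]
    box_free_mono[of V W X Y col p q]
  by (simp add: mult_def of_bool_def)

lemma loop_mono: "V \<subseteq> W \<Longrightarrow> loop X Y W p \<le> loop X Y V p"
  unfolding loop_def by (auto simp: of_bool_def)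

lemma mult_eq_1_same: "col p = col q \<Longrightarrow> mult X Y col V p q = Suc 0 \<longleftrightarrow> box_free X Y col V p q"
  by (simp add: mult_def of_bool_def)

lemma mult_eq_2_iff:
  "mult X Y col V p q = 2 \<longleftrightarrow> col p \<noteq> col q \<and> mixed_free X Y col V p q \<and> mixed_free Y X col V p q"
  by (auto simp: mult_def)

section \<open>Losses when points are deleted\<close>

text \<open>An edge inside \<open>D\<close> enters the degrees at both of its ends. An edge leaving
  \<open>D\<close> enters one degree in \<open>D\<close> and one degree outside; the last sum
  accounts for the latter.\<close>

lemma weight_delete_set:
  assumes "finite V" "D \<subseteq> V"
  shows "weight X Y col V \<le> weight X Y col (V - D) +
           (\<Sum>d\<in>D. deg X Y col V d + loop X Y V d + (\<Sum>p\<in>V - D. mult X Y col V d p))"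
proof -
  let ?m = "mult X Y col V" and ?l = "loop X Y V" and ?W = "V - D"
  have fin: "finite D" "finite ?W" using assms finite_subset by auto
  have le: "deg X Y col V p + ?l p \<le> (\<Sum>d\<in>D. ?m d p) + (deg X Y col ?W p + loop X Y ?W p)"
    if p: "p \<in> ?W" for p
  proof -
    have "V - {p} = D \<union> (?W - {p})" "D \<inter> (?W - {p}) = {}" using p assms by auto
    then have "(\<Sum>q\<in>V - {p}. ?m p q) = (\<Sum>d\<in>D. ?m p d) + (\<Sum>q\<in>?W - {p}. ?m p q)"
      using fin by (simp add: sum.union_disjoint)
    moreover have "(\<Sum>d\<in>D. ?m p d) = (\<Sum>d\<in>D. ?m d p)"
      by (intro sum.cong refl mult_sym)
    moreover have "(\<Sum>q\<in>?W - {p}. ?m p q) \<le> (\<Sum>q\<in>?W - {p}. mult X Y col ?W p q)"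
      by (intro sum_mono mult_mono) auto
    moreover have "?l p \<le> loop X Y ?W p" by (intro loop_mono) auto
    ultimately show ?thesis by (simp add: deg_def)
  qed
  have "weight X Y col V = (\<Sum>p\<in>D. deg X Y col V p + ?l p) + (\<Sum>p\<in>?W. deg X Y col V p + ?l p)"
    unfolding weight_def by (subst sum.subset_diff[OF assms(2,1)]) (rule add.commute)
  moreover have "(\<Sum>p\<in>?W. deg X Y col V p + ?l p)
      \<le> (\<Sum>p\<in>?W. (\<Sum>d\<in>D. ?m d p) + (deg X Y col ?W p + loop X Y ?W p))"
    by (intro sum_mono le)
  moreover have "\<dots> = (\<Sum>p\<in>?W. \<Sum>d\<in>D. ?m d p) + weight X Y col ?W"
    unfolding weight_def by (rule sum.distrib)
  moreover have "(\<Sum>p\<in>?W. \<Sum>d\<in>D. ?m d p) = (\<Sum>d\<in>D. \<Sum>p\<in>?W. ?m d p)"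
    by (rule sum.swap)
  moreover have "(\<Sum>d\<in>D. deg X Y col V d + ?l d + (\<Sum>p\<in>?W. ?m d p))
      = (\<Sum>d\<in>D. deg X Y col V d + ?l d) + (\<Sum>d\<in>D. \<Sum>p\<in>?W. ?m d p)"
    by (rule sum.distrib)
  ultimately show ?thesis by linarith
qed

lemma weight_delete:
  assumes "finite V" "v \<in> V"
  shows "weight X Y col V \<le> weight X Y col (V - {v}) + 2 * deg X Y col V v"
  using weight_delete_set[of V "{v}" X Y col] assms by (simp add: deg_def)

text \<open>The edges between \<open>u\<close> and \<open>v\<close> lie in both degrees but
  disappear only once; crediting them back is what lets a double edge pay for two exceptional
  points.\<close>

lemma weight_delete_pair:
  assumes "finite V" "u \<in> V" "v \<in> V" "u \<noteq> v"
  shows "weight X Y col V + 2 * mult X Y col V u v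
       \<le> weight X Y col (V - {u, v}) + 2 * (deg X Y col V u + deg X Y col V v)"
proof -
  let ?m = "mult X Y col V" and ?W = "V - {u, v}"
  have split: "deg X Y col V a = loop X Y V a + (?m a b + (\<Sum>q\<in>?W. ?m a q))"
    if "{a, b} = {u, v}" for a b
  proof -
    have "V - {a} = insert b ?W" "b \<notin> ?W" using that assms by auto
    then show ?thesis unfolding deg_def using assms(1) by (metis finite_Diff sum.insert)
  qed
  have "weight X Y col V \<le> weight X Y col ?W +
      (\<Sum>d\<in>{u, v}. deg X Y col V d + loop X Y V d + (\<Sum>p\<in>?W. ?m d p))"
    by (rule weight_delete_set) (use assms in auto)
  also have "\<dots> = weight X Y col ?W +
      (deg X Y col V u + loop X Y V u + (\<Sum>p\<in>?W. ?m u p)) +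
      (deg X Y col V v + loop X Y V v + (\<Sum>p\<in>?W. ?m v p))"
    using assms(4) by simp
  finally show ?thesis
    using split[of u v] split[of v u] mult_sym[of X Y col V v u] by (auto simp: insert_commute)
qed

section \<open>Points extreme in one coordinate\<close>

text \<open>Without a double edge at \<open>R\<close>, the loop and one edge per other point give
  \<open>low\<close>. A loop at \<open>R\<close> costs a unit that the count for a pair cannot
  spare, but for the rightmost point it forces the bottom right corner. There only one double edge
  is possible, so \<open>low\<close> fails by at most one, and only if every other point is joined
  to \<open>R\<close>.\<close>

lemma extreme_vertex:
  fixes X :: "'a \<Rightarrow> 'b::linorder" and Y :: "'a \<Rightarrow> 'c::linorder"
  assumes fin: "finite V" and inj: "inj_on X V" "inj_on Y V"
    and R: "R \<in> V" and last: "\<And>r. r \<in> V \<Longrightarrow> X r \<le> X R"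
  obtains
    (low) "deg X Y col V R \<le> card V"
  | (pair) q where "q \<in> V" "q \<noteq> R"
      "deg X Y col V R + deg X Y col V q \<le> 2 * card V + mult X Y col V R q"
  | (corner) q where "q \<in> V" "col q \<noteq> col R" "\<And>r. r \<in> V \<Longrightarrow> r \<noteq> R \<Longrightarrow> Y R < Y r"
      "\<And>r. r \<in> V \<Longrightarrow> r \<noteq> R \<Longrightarrow> mult X Y col V R r \<ge> 1"
      "\<And>r. r \<in> V \<Longrightarrow> r \<noteq> R \<Longrightarrow> mult X Y col V R r = 2 \<longleftrightarrow> r = q"
proof -
  let ?m = "mult X Y col V" and ?l = "loop X Y V" and ?d = "deg X Y col V"
  define N where "N = {r \<in> V. ?m R r = 2}"
  have XR: "X r < X R" if "r \<in> V" "r \<noteq> R" for r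
    using last[OF that(1)] inj(1) R that by (metis inj_onD order_neq_le_trans)
  have Yne: "Y r \<noteq> Y s" if "r \<in> V" "s \<in> V" "r \<noteq> s" for r s
    using inj(2) that by (meson inj_onD)
  have Ncol: "r \<in> V" "r \<noteq> R" "col r \<noteq> col R" if "r \<in> N" for r
    using that unfolding N_def by (auto simp: mult_eq_2_iff)
  \<comment> \<open>The alternative \<open>X R < X t\<close> is void because \<open>R\<close> is
    rightmost, so the strip between a point of \<open>N\<close> and \<open>R\<close> holds no point
    of the colour of \<open>R\<close>.\<close>
  have Nup: "(if col t = col R then False else X r < X t)"
    if "r \<in> N" "t \<in> V" "btw (Y R) (Y t) (Y r)" for r t
  proof -
    have "if col t = col R then X R < X t else X r < X t"
      using that by (simp add: N_def mult_eq_2_iff mixed_free_def)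
    then show ?thesis using last[OF that(2)] by (auto split: if_splits)
  qed
  have Nright: "(if col t = col R then Y R < Y t else Y r < Y t)"
    if "r \<in> N" "t \<in> V" "t \<noteq> R" "X r < X t" for r t
  proof -
    have "btw (X R) (X t) (X r)" using that XR[of t] by (simp add: btw_def)
    then show ?thesis using that by (simp add: N_def mult_eq_2_iff mixed_free_def)
  qed
  \<comment> \<open>All points of \<open>N\<close> have the colour opposite to \<open>R\<close>, so
    \<open>Nright\<close> makes \<open>N\<close> an increasing chain; its highest point is also its
    rightmost.\<close>
  have Nrise: "X r < X s" if "r \<in> N" "s \<in> N" "Y r < Y s" for r s
  proof (rule ccontr)
    assume "\<not> X r < X s"
    moreover have "X r \<noteq> X s" using that Ncol inj(1) by (metis inj_onD less_irrefl)
    ultimately have "X s < X r" by simp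
    then show False using Nright[of s r] Ncol that by auto
  qed
  have deg_R: "?d R = ?l R + (\<Sum>r\<in>V - {R}. ?m R r)" by (simp add: deg_def)
  have sum_R: "(\<Sum>r\<in>V - {R}. ?m R r) \<le> (card V - 1) + card N"
  proof -
    have "(\<Sum>r\<in>V - {R}. ?m R r) \<le> (\<Sum>r\<in>V - {R}. 1 + of_bool (r \<in> N))"
      using mult_le_2[of X Y col V R] by (intro sum_mono) (auto simp: N_def le_Suc_eq numeral_2_eq_2)
    also have "\<dots> = card (V - {R}) + (\<Sum>r\<in>V - {R}. of_bool (r \<in> N))"
      unfolding sum.distrib by simp
    also have "(\<Sum>r\<in>V - {R}. of_bool (r \<in> N)) = card ((V - {R}) \<inter> N)"
      using fin by (simp add: of_bool_def sum.If_cases)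
    also have "(V - {R}) \<inter> N = N" using Ncol by auto
    finally show ?thesis using fin R by simp
  qed
  have cV: "card V \<ge> 1" using fin R by (metis One_nat_def Suc_leI card_gt_0_iff empty_iff)
  show thesis
  proof (cases "N = {}")
    case True
    then show thesis using low deg_R sum_R loop_le[of X Y V R] cV by simp
  next
    case False
    have finN: "finite N" using fin by (simp add: N_def)
    have "Max (Y ` N) \<in> Y ` N" using finN False by (intro Max_in) auto
    then obtain q where q: "q \<in> N" "Y q = Max (Y ` N)" by auto
    have qmax: "Y r < Y q" if "r \<in> N" "r \<noteq> q" for r
      using that q finN Ncol Yne[of r q] by (metis Max_ge finite_imageI imageI order_neq_le_trans)
    note qV = Ncol[OF q(1)]
    show thesis
    proof (cases "?l R = 1")
      case True
      then have low_R: "Y R < Y r" if "r \<in> V" "r \<noteq> R" for r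
      proof -
        have "\<not> Y r < Y R" using True that XR[of r] by (simp add: loop_def of_bool_def split: if_splits)
        then show ?thesis using Yne[OF R that(1)] that by auto
      qed
      \<comment> \<open>With \<open>R\<close> at the bottom, a lower point of the chain would lie in
        the strip between \<open>R\<close> and \<open>q\<close> but to the left of \<open>q\<close>,
        against \<open>Nup\<close>.\<close>
      have Nq: "r = q" if "r \<in> N" for r
      proof (rule ccontr)
        assume "r \<noteq> q"
        then have "Y r < Y q" "X r < X q" using qmax Nrise that q(1) by auto
        moreover have "Y R < Y r" using low_R Ncol that by blast
        ultimately show False
          using Nup[of q r] q(1) Ncol[OF that] by (auto simp: btw_def split: if_splits)
      qed
      then have cN: "card N = 1" using q(1) by (simp add: card_1_singleton_iff) blast
      show thesis
      proof (cases "\<exists>r\<in>V. r \<noteq> R \<and> ?m R r = 0")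
        case True
        then obtain r0 where r0: "r0 \<in> V" "r0 \<noteq> R" "?m R r0 = 0" by blast
        \<comment> \<open>One unjoined point balances the surplus from \<open>q\<close>: the loop,
          one edge for each of the other \<open>card V - 2\<close> points and one more for
          \<open>q\<close> add up to \<open>card V\<close>.\<close>
        have "(\<Sum>r\<in>V - {R}. ?m R r) = (\<Sum>r\<in>V - {R} - {r0}. ?m R r)"
          using r0 fin by (simp add: sum.remove[of "V - {R}" r0])
        also have "\<dots> \<le> (\<Sum>r\<in>V - {R} - {r0}. 1 + of_bool (r = q))"
        proof (intro sum_mono)
          fix r assume "r \<in> V - {R} - {r0}"
          then show "?m R r \<le> 1 + of_bool (r = q)"
            using Nq[of r] mult_le_2[of X Y col V R r] by (cases "?m R r = 2") (auto simp: N_def)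
        qed
        also have "\<dots> \<le> (card V - 2) + 1"
          unfolding sum.distrib using r0 R fin by (simp add: of_bool_def numeral_2_eq_2)
        finally show thesis using low deg_R True loop_le[of X Y V R] card_mono[OF fin, of "{R, r0}"] r0 R by simp
      next
        case False
        show thesis
        proof (rule corner[of q])
          show "?m R r = 2 \<longleftrightarrow> r = q" if "r \<in> V" "r \<noteq> R" for r
            using Nq[of r] q(1) that by (auto simp: N_def)
          show "?m R r \<ge> 1" if "r \<in> V" "r \<noteq> R" for r
            using False that by (auto simp: Suc_le_eq)
        qed (use qV low_R in blast)+
      qed
    next
      case False
      then have lR: "?l R = 0" using loop_le[of X Y V R] by linarith
      \<comment> \<open>These sets collect the points that send three edges to
        \<open>{R, q}\<close>: two to \<open>R\<close> and one to \<open>q\<close> in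
        \<open>E1\<close>, one to \<open>R\<close> and two to \<open>q\<close> in \<open>F\<close>,
        split into the points above and below \<open>R\<close>. No point sends four, since it shares
        its colour with \<open>R\<close> or with \<open>q\<close>.\<close>
      define E1 where "E1 = {r \<in> N. r \<noteq> q \<and> box_free X Y col V q r}"
      define F where "F = {r \<in> V. r \<noteq> R \<and> col r = col R \<and> box_free X Y col V R r \<and> ?m q r = 2}"
      define E2 where "E2 = {r \<in> F. Y R < Y r}"
      define E3 where "E3 = {r \<in> F. Y r < Y R}"
      have finE: "finite E1" "finite E2" "finite E3"
        using fin finN by (auto simp: E1_def E2_def E3_def F_def)
      have F_up: "(if col t = col R then X r < X t else X q < X t)"
        if "r \<in> F" "t \<in> V" "btw (Y q) (Y t) (Y r)" for r t
        using that qV(3) unfolding F_def mult_eq_2_iff mixed_free_def by (auto split: if_splits)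
      have F_box: False
        if "r \<in> F" "t \<in> V" "col t = col R" "X r < X t" "t \<noteq> R" "btw (Y R) (Y t) (Y r)" for r t
        using that XR[of t] unfolding F_def box_free_def btw_def by blast
      \<comment> \<open>Both points lie above \<open>R\<close> and above \<open>q\<close>.
        \<open>F_up\<close> demands that the higher one be further left, but then the lower one lies
        in the rectangle of \<open>R\<close> and the higher one, against
        \<open>F_box\<close>.\<close>
      have E2: "r = s" if "r \<in> E2" "s \<in> E2" for r s
      proof -
        have aux: False if "r \<in> E2" "s \<in> E2" "Y r < Y s" for r s
        proof -
          have r: "r \<in> F" "Y R < Y r" "r \<in> V" "r \<noteq> R" "col r = col R" using that by (auto simp: E2_def F_def)
          have s: "s \<in> F" using that by (auto simp: E2_def)
          have n: "\<not> X s < X r"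
            using F_box[of s r] r s that by (auto simp: btw_def)
          have "\<not> btw (Y R) (Y r) (Y q)" using Nup[OF q(1), of r] r by auto
          moreover have "Y q \<noteq> Y r" using r Yne[of q r] qV by metis
          ultimately have "Y q < Y r" using r(2) by (metis btw_def linorder_neqE)
          then have "X s < X r" using F_up[of s r] r s that by (auto simp: btw_def split: if_splits)
          then show False using n by simp
        qed
        have "\<not> Y r < Y s" "\<not> Y s < Y r" using aux that by blast+
        then show ?thesis using Yne[of r s] that by (auto simp: E2_def F_def)
      qed
      \<comment> \<open>A point below \<open>R\<close> of its colour is kept away from the right of
        \<open>q\<close> by \<open>Nright\<close> and out of the strip between \<open>R\<close> and
        \<open>q\<close> by \<open>Nup\<close>.\<close>
      have E3_sw: "X r < X q" "Y r < Y q" if "r \<in> E3" for r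
      proof -
        have r: "r \<in> F" "Y r < Y R" "r \<in> V" "r \<noteq> R" "col r = col R" using that by (auto simp: E3_def F_def)
        have "\<not> X q < X r" using Nright[OF q(1), of r] r by auto
        then show "X r < X q" using r qV inj(1) by (metis inj_onD linorder_neqE)
        have "\<not> btw (Y R) (Y r) (Y q)" using Nup[OF q(1), of r] r by auto
        moreover have "Y q \<noteq> Y r" using r Yne[of q r] qV by metis
        ultimately show "Y r < Y q" using r(2) by (metis btw_def linorder_neqE)
      qed
      \<comment> \<open>Now \<open>F_up\<close> places the higher point further right, that is,
        inside the rectangle of \<open>R\<close> and the lower one.\<close>
      have E3: "r = s" if "r \<in> E3" "s \<in> E3" for r s
      proof -
        have aux: False if "r \<in> E3" "s \<in> E3" "Y r < Y s" for r s
        proof -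
          have r: "r \<in> F" using that by (auto simp: E3_def)
          have s: "s \<in> F" "Y s < Y R" "s \<in> V" "s \<noteq> R" "col s = col R" using that by (auto simp: E3_def F_def)
          have "X r < X s"
            using F_up[of r s] r s that E3_sw[of s] by (auto simp: btw_def split: if_splits)
          then show False using F_box[of r s] r s that by (auto simp: btw_def)
        qed
        have "\<not> Y r < Y s" "\<not> Y s < Y r" using aux that by blast+
        then show ?thesis using Yne[of r s] that by (auto simp: E3_def F_def)
      qed
      \<comment> \<open>Of three chain points of equal colour the middle one lies in the rectangle
        of the outer two, so at most the immediate predecessor of \<open>q\<close>
        qualifies.\<close>
      have E1: "r = s" if "r \<in> E1" "s \<in> E1" for r s
      proof -
        have aux: False if "r \<in> E1" "s \<in> E1" "Y r < Y s" for r s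
        proof -
          have rs: "r \<in> N" "s \<in> N" "r \<noteq> q" "s \<noteq> q" "box_free X Y col V q r" using that by (auto simp: E1_def)
          then have "X r < X s" "X s < X q" "Y s < Y q" using Nrise qmax q(1) that by auto
          then show False using rs that Ncol[of s] qV by (auto simp: box_free_def btw_def)
        qed
        have "\<not> Y r < Y s" "\<not> Y s < Y r" using aux that by blast+
        then show ?thesis using Yne[of r s] that Ncol by (auto simp: E1_def)
      qed
      \<comment> \<open>By \<open>Nup\<close> the point \<open>t\<close> lies below
        \<open>r\<close>; hence \<open>r\<close> is in the strip between \<open>t\<close> and
        \<open>q\<close> and would have to be to the right of \<open>q\<close>.\<close>
      have E13: False if "r \<in> E1" "t \<in> E3" for r t
      proof -
        have r: "r \<in> N" "r \<noteq> q" using that by (auto simp: E1_def)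
        have t: "t \<in> F" "Y t < Y R" "t \<in> V" "t \<noteq> R" "col t = col R" using that by (auto simp: E3_def F_def)
        have q': "Y r < Y q" "X r < X q" using qmax Nrise q(1) r by auto
        have "\<not> btw (Y R) (Y t) (Y r)" using Nup[OF r(1), of t] t by auto
        moreover have "Y t \<noteq> Y r" using t Yne[of t r] Ncol[OF r(1)] by metis
        ultimately have "Y t < Y r" using t(2) by (metis btw_def linorder_neqE)
        then show False using F_up[of t r] t q' Ncol[OF r(1)] by (auto simp: btw_def)
      qed
      have l_E1: "?l q = 0" if "r \<in> E1" for r
        using that qmax Nrise q(1) Ncol[of r] by (auto simp: E1_def loop_def)
      have l_E3: "?l q = 0" if "r \<in> E3" for r
        using that E3_sw[OF that] by (auto simp: E3_def F_def loop_def)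
      have single: "card E \<le> 1" if "finite E" "\<And>r s. r \<in> E \<Longrightarrow> s \<in> E \<Longrightarrow> r = s" for E :: "'a set"
        using that by (metis card_le_Suc0_iff_eq One_nat_def)
      have cards: "card E1 \<le> 1" "card E2 \<le> 1" "card E3 \<le> 1"
        using single finE E1 E2 E3 by blast+
      \<comment> \<open>A point of \<open>E1\<close> or \<open>E3\<close> lies below and to the left
        of \<open>q\<close> and so destroys its loop. These three share one unit of excess;
        \<open>E2\<close> has the other.\<close>
      have ex: "card E1 + card E3 + ?l q \<le> 1"
      proof (cases "E1 = {}")
        case True
        then show ?thesis
          using cards l_E3 loop_le[of X Y V q] by (cases "E3 = {}") auto
      next
        case False
        then have "E3 = {}" "?l q = 0" using E13 l_E1 by blast+
        then show ?thesis using cards by simp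
      qed
      let ?W = "V - {R} - {q}"
      have each: "?m R r + ?m q r \<le> 2 + (of_bool (r \<in> E1) + of_bool (r \<in> E2) + of_bool (r \<in> E3))"
        if r: "r \<in> ?W" for r
      proof (cases "col r = col R")
        case True
        have "?m R r \<le> 1" using True by (intro mult_le_1) simp
        moreover have "?m q r \<le> 2" by (rule mult_le_2)
        moreover have "r \<in> E2 \<or> r \<in> E3" if "?m R r = 1" "?m q r = 2"
          using that r True Yne[of r R] R by (auto simp: E2_def E3_def F_def mult_eq_1_same)
        ultimately show ?thesis by (cases "?m R r = 1 \<and> ?m q r = 2") auto
      next
        case False
        then have c: "col r = col q" using qV(3) by auto
        have "?m q r \<le> 1" using c by (intro mult_le_1) simp
        moreover have "?m R r \<le> 2" by (rule mult_le_2)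
        moreover have "r \<in> E1" if "?m R r = 2" "?m q r = 1"
          using that r c by (auto simp: E1_def N_def mult_eq_1_same)
        ultimately show ?thesis by (cases "?m R r = 2 \<and> ?m q r = 1") auto
      qed
      have cW: "card ?W = card V - 2" using R qV fin by simp
      have "(\<Sum>r\<in>?W. ?m R r + ?m q r)
          \<le> (\<Sum>r\<in>?W. 2 + (of_bool (r \<in> E1) + of_bool (r \<in> E2) + of_bool (r \<in> E3)))"
        by (intro sum_mono each)
      moreover have "(\<Sum>r\<in>?W. 2 + (of_bool (r \<in> E1) + of_bool (r \<in> E2) + of_bool (r \<in> E3)))
          = 2 * card ?W + ((\<Sum>r\<in>?W. of_bool (r \<in> E1)) + (\<Sum>r\<in>?W. of_bool (r \<in> E2)) + (\<Sum>r\<in>?W. of_bool (r \<in> E3)) :: nat)"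
        unfolding sum.distrib by simp
      moreover have "(\<Sum>r\<in>?W. of_bool (r \<in> E)) \<le> card E" if "finite E" for E
      proof -
        have "(\<Sum>r\<in>?W. of_bool (r \<in> E)) = card (?W \<inter> E)"
          using fin by (simp add: of_bool_def sum.If_cases)
        then show ?thesis using that by (simp add: card_mono)
      qed
      from this[OF finE(1)] this[OF finE(2)] this[OF finE(3)]
      have "(\<Sum>r\<in>?W. of_bool (r \<in> E1)) + (\<Sum>r\<in>?W. of_bool (r \<in> E2)) + (\<Sum>r\<in>?W. of_bool (r \<in> E3))
        \<le> card E1 + card E2 + card E3" by linarith
      ultimately have S: "(\<Sum>r\<in>?W. ?m R r) + (\<Sum>r\<in>?W. ?m q r) \<le> 2 * (card V - 2) + (card E1 + card E2 + card E3)"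
        unfolding cW sum.distrib by linarith
      have dR: "?d R = ?l R + (?m R q + (\<Sum>r\<in>?W. ?m R r))"
        unfolding deg_def using qV fin by (simp add: sum.remove[of "V - {R}" q])
      have dq: "?d q = ?l q + (?m q R + (\<Sum>r\<in>?W. ?m q r))"
      proof -
        have "V - {q} = insert R ?W" "R \<notin> ?W" using R qV by auto
        then show ?thesis unfolding deg_def using fin by (metis finite_Diff sum.insert)
      qed
      have mq: "?m R q = 2" using q(1) by (simp add: N_def)
      have c2: "card V \<ge> 2" using card_mono[OF fin, of "{R, q}"] R qV by simp
      show thesis
        by (rule pair[of q]) (use qV dR dq S mq lR ex cards c2 mult_sym[of X Y col V q R] in linarith)+
    qed
  qed
qed

lemma ex_maximum_on:
  fixes f :: "'a \<Rightarrow> 'b::linorder"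
  assumes "finite V" "V \<noteq> {}"
  shows "\<exists>R\<in>V. \<forall>r\<in>V. f r \<le> f R"
proof -
  have "Max (f ` V) \<in> f ` V" using assms by (intro Max_in) auto
  then obtain R where "R \<in> V" "f R = Max (f ` V)" by auto
  then show ?thesis using assms(1) by (intro bexI[of _ R]) auto
qed

text \<open>Five points guarantee one outside \<open>{R, T, q, q'}\<close> when both extreme points
  are corners of equal colour; corners of different colours are contradictory.\<close>

lemma removable:
  fixes X :: "'a \<Rightarrow> 'b::linorder" and Y :: "'a \<Rightarrow> 'c::linorder"
  assumes fin: "finite V" and inj: "inj_on X V" "inj_on Y V" and card: "card V \<ge> 5"
  obtains
    (vertex) v where "v \<in> V" "deg X Y col V v \<le> card V"
  | (pair) u v where "u \<in> V" "v \<in> V" "u \<noteq> v"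
      "deg X Y col V u + deg X Y col V v \<le> 2 * card V + mult X Y col V u v"
proof -
  have ne: "V \<noteq> {}" using card by auto
  note ex = ex_maximum_on[OF fin ne]
  obtain R where R: "R \<in> V" "\<And>r. r \<in> V \<Longrightarrow> X r \<le> X R" using ex[of X] by blast
  obtain T where T: "T \<in> V" "\<And>r. r \<in> V \<Longrightarrow> Y r \<le> Y T" using ex[of Y] by blast
  show thesis
  proof (rule extreme_vertex[OF fin inj R, of col])
    fix q assume q: "q \<in> V" "col q \<noteq> col R" "\<And>r. r \<in> V \<Longrightarrow> r \<noteq> R \<Longrightarrow> Y R < Y r"
      "\<And>r. r \<in> V \<Longrightarrow> r \<noteq> R \<Longrightarrow> mult X Y col V R r \<ge> 1"
      "\<And>r. r \<in> V \<Longrightarrow> r \<noteq> R \<Longrightarrow> mult X Y col V R r = 2 \<longleftrightarrow> r = q"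
    show thesis
    proof (rule extreme_vertex[OF fin inj(2,1) T, of col])
      fix q' assume q': "q' \<in> V" "col q' \<noteq> col T" "\<And>r. r \<in> V \<Longrightarrow> r \<noteq> T \<Longrightarrow> X T < X r"
        "\<And>r. r \<in> V \<Longrightarrow> r \<noteq> T \<Longrightarrow> mult Y X col V T r \<ge> 1"
        "\<And>r. r \<in> V \<Longrightarrow> r \<noteq> T \<Longrightarrow> mult Y X col V T r = 2 \<longleftrightarrow> r = q'"
      have TR: "T \<noteq> R" using q q' T(2)[of q] by (metis leD)
      have XR: "X r < X R" if "r \<in> V" "r \<noteq> R" for r
        using R(2)[OF that(1)] inj(1) R(1) that by (metis inj_onD order_neq_le_trans)
      have YT: "Y r < Y T" if "r \<in> V" "r \<noteq> T" for r
        using T(2)[OF that(1)] inj(2) T(1) that by (metis inj_onD order_neq_le_trans)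
      have btwX: "btw (X R) (X r) (X T)" and btwY: "btw (Y R) (Y r) (Y T)"
        if "r \<in> V" "r \<noteq> R" "r \<noteq> T" for r
        using that XR q'(3) YT q(3) by (auto simp: btw_def)
      have m1: "mult X Y col V R T \<ge> 1" using q(4) T(1) TR by blast
      have qT: "mult X Y col V T R = 2 \<longleftrightarrow> R = q'" using q'(5)[of R] R(1) TR by (simp add: mult_swap[of Y X])
      show thesis
      proof (cases "col T = col R")
        case True
        \<comment> \<open>The rectangle of the two corners contains every other point, so all of
          these have the other colour. One that differs from \<open>q\<close> and \<open>q'\<close>
          has at most a loop and a single edge to each point.\<close>
        then have bf: "box_free X Y col V R T" using m1 by (simp add: mult_def of_bool_def split: if_splits)
        have opp: "col r \<noteq> col R" if "r \<in> V" "r \<noteq> R" "r \<noteq> T" for r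
          using bf btwX[OF that] btwY[OF that] that(1) by (auto simp: box_free_def)
        have "card (V - {R, T, q, q'}) > 0"
        proof -
          have "card {R, T, q, q'} \<le> 4" by (simp add: card_insert_if)
          then show ?thesis using diff_card_le_card_Diff[of "{R, T, q, q'}" V] card by simp
        qed
        then obtain s where s: "s \<in> V" "s \<noteq> R" "s \<noteq> T" "s \<noteq> q" "s \<noteq> q'"
          by (auto simp: card_gt_0_iff)
        have "mult X Y col V s R \<le> 1"
          using q(5)[of s] s mult_le_2[of X Y col V R s] by (auto simp: mult_sym[of X Y col V s R])
        moreover have "mult X Y col V s T \<le> 1"
          using q'(5)[of s] s mult_le_2[of X Y col V T s]
          by (auto simp: mult_sym[of X Y col V s T] mult_swap[of Y X])
        moreover have "(\<Sum>r\<in>V - {s} - {R} - {T}. mult X Y col V s r) \<le> (\<Sum>r\<in>V - {s} - {R} - {T}. 1)"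
        proof (rule sum_mono)
          fix r assume "r \<in> V - {s} - {R} - {T}"
          then have "col s = col r" using opp[of r] opp[of s] s by auto
          then show "mult X Y col V s r \<le> 1" by (rule mult_le_1)
        qed
        moreover have "deg X Y col V s = loop X Y V s + (mult X Y col V s R + (mult X Y col V s T
            + (\<Sum>r\<in>V - {s} - {R} - {T}. mult X Y col V s r)))"
          unfolding deg_def using fin s R(1) T(1) TR
          by (simp add: sum.remove[of "V - {s}" R] sum.remove[of "V - {s} - {R}" T])
        moreover have "card (V - {s} - {R} - {T}) = card V - 3"
          using fin s R(1) T(1) TR by simp
        ultimately have "deg X Y col V s \<le> card V"
          using card loop_le[of X Y V s] by simp
        then show thesis using vertex s(1) by blast
      next
        case False
        \<comment> \<open>Every other point lies in both strips, so one mixed condition forces a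
          common colour on all of them. Since \<open>q\<close> is coloured unlike \<open>R\<close>
          and \<open>q'\<close> unlike \<open>T\<close>, one of the two must be the opposite corner,
          and the edge between the corners is double. Both conditions together leave no colour for a
          third point.\<close>
        have "mixed_free X Y col V R T \<or> mixed_free Y X col V R T"
          using m1 False by (auto simp: mult_def of_bool_def split: if_splits)
        then have mono: "(\<forall>r\<in>V. r \<noteq> R \<longrightarrow> r \<noteq> T \<longrightarrow> col r = col T) \<or> (\<forall>r\<in>V. r \<noteq> R \<longrightarrow> r \<noteq> T \<longrightarrow> col r = col R)"
        proof
          assume a: "mixed_free X Y col V R T"
          have "col r = col T" if "r \<in> V" "r \<noteq> R" "r \<noteq> T" for r
          proof (rule ccontr)
            assume "col r \<noteq> col T"
            then have "X R < X r" using a btwY[OF that] that(1) False by (auto simp: mixed_free_def)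
            then show False using XR[OF that(1,2)] by simp
          qed
          then show ?thesis by blast
        next
          assume a: "mixed_free Y X col V R T"
          have "col r = col R" if "r \<in> V" "r \<noteq> R" "r \<noteq> T" for r
          proof (rule ccontr)
            assume "col r \<noteq> col R"
            then have "Y T < Y r" using a btwX[OF that] that(1) by (auto simp: mixed_free_def)
            then show False using YT[OF that(1,3)] by simp
          qed
          then show ?thesis by blast
        qed
        have "q = T \<or> q' = R"
          using mono q(1,2) q'(1,2) False by metis
        then have two: "mult X Y col V R T = 2"
          using q(5)[of T] T(1) TR qT mult_sym[of X Y col V T R] by auto
        have "card (V - {R, T}) > 0"
        proof -
          have "card {R, T} \<le> 2" by (simp add: card_insert_if)
          then show ?thesis using diff_card_le_card_Diff[of "{R, T}" V] card by simp
        qed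
        then obtain s where s: "s \<in> V" "s \<noteq> R" "s \<noteq> T" by (auto simp: card_gt_0_iff)
        have "if col s = col R then X R < X s else X T < X s" "if col s = col R then Y R < Y s else Y T < Y s"
          using two btwX[OF s] btwY[OF s] s(1) by (auto simp: mult_eq_2_iff mixed_free_def)
        then have False using XR[OF s(1,2)] YT[OF s(1,3)] by (auto split: if_splits)
        then show thesis ..
      qed
    next
      assume "deg Y X col V T \<le> card V"
      then show thesis using vertex[OF T(1)] by (simp add: deg_swap[of Y X])
    next
      fix q' assume "q' \<in> V" "q' \<noteq> T"
        "deg Y X col V T + deg Y X col V q' \<le> 2 * card V + mult Y X col V T q'"
      then show thesis using pair[OF T(1)] by (simp add: deg_swap[of Y X] mult_swap[of Y X])
    qed
  next
    assume "deg X Y col V R \<le> card V"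
    then show thesis by (rule vertex[OF R(1)])
  next
    fix q' assume "q' \<in> V" "q' \<noteq> R"
      "deg X Y col V R + deg X Y col V q' \<le> 2 * card V + mult X Y col V R q'"
    then show thesis using pair[OF R(1)] by simp
  qed
qed

section \<open>Exhaustive check of at most five points\<close>

lemma weight_image:
  assumes inj: "inj_on G V"
    and X: "\<And>r s. r \<in> V \<Longrightarrow> s \<in> V \<Longrightarrow> X' (G r) < X' (G s) \<longleftrightarrow> X r < X s"
    and Y: "\<And>r s. r \<in> V \<Longrightarrow> s \<in> V \<Longrightarrow> Y' (G r) < Y' (G s) \<longleftrightarrow> Y r < Y s"
    and col: "\<And>r s. r \<in> V \<Longrightarrow> s \<in> V \<Longrightarrow> col' (G r) = col' (G s) \<longleftrightarrow> col r = col s"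
  shows "weight X' Y' col' (G ` V) = weight X Y col V"
proof -
  have l: "loop X' Y' (G ` V) (G p) = loop X Y V p" if "p \<in> V" for p
    using that X Y by (simp add: loop_def)
  have m: "mult X' Y' col' (G ` V) (G p) (G q) = mult X Y col V p q" if "p \<in> V" "q \<in> V" for p q
    using that X Y col by (simp add: mult_def box_free_def mixed_free_def btw_def)
  have d: "deg X' Y' col' (G ` V) (G p) = deg X Y col V p" if p: "p \<in> V" for p
  proof -
    have "G ` V - {G p} = G ` (V - {p})" using inj p by (auto simp: inj_on_def)
    moreover have "inj_on G (V - {p})" using inj by (rule inj_on_diff)
    ultimately show ?thesis using p l m by (simp add: deg_def sum.reindex)
  qed
  show ?thesis using inj d l by (simp add: weight_def sum.reindex)
qed

definition height :: "nat \<times> nat \<times> bool \<Rightarrow> nat" where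
  "height t = fst (snd t)"

definition colour :: "nat \<times> nat \<times> bool \<Rightarrow> bool" where
  "colour t = snd (snd t)"

fun mult_list :: "(nat \<times> nat \<times> bool) list \<Rightarrow> nat \<times> nat \<times> bool \<Rightarrow> nat \<times> nat \<times> bool \<Rightarrow> nat" where
  "mult_list L (x, y, c) (x', y', c') =
     (if c = c'
      then if list_all (\<lambda>(u, v, d). d = c \<longrightarrow> btw x u x' \<longrightarrow> \<not> btw y v y') L then 1 else 0
      else (if list_all (\<lambda>(u, v, d). btw y v y' \<longrightarrow> (if d = c then x < u else x' < u)) L then 1 else 0)
         + (if list_all (\<lambda>(u, v, d). btw x u x' \<longrightarrow> (if d = c then y < v else y' < v)) L then 1 else 0))"

fun loop_list :: "(nat \<times> nat \<times> bool) list \<Rightarrow> nat \<times> nat \<times> bool \<Rightarrow> nat" where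
  "loop_list L (x, y, c) = (if list_all (\<lambda>(u, v, d). u < x \<longrightarrow> \<not> v < y) L then 1 else 0)"

fun half_weight :: "(nat \<times> nat \<times> bool) list \<Rightarrow> (nat \<times> nat \<times> bool) list \<Rightarrow> nat" where
  "half_weight L [] = 0"
| "half_weight L (p # ps) = loop_list L p + sum_list (map (mult_list L p) ps) + half_weight L ps"

lemma mult_list: "mult_list L p q = mult fst height colour (set L) p q"
proof -
  obtain x y c x' y' c' where pq: "p = (x, y, c)" "q = (x', y', c')" by (metis prod_cases3)
  have b: "box_free fst height colour (set L) p q \<longleftrightarrow>
      list_all (\<lambda>(u, v, d). d = c \<longrightarrow> btw x u x' \<longrightarrow> \<not> btw y v y') L"
    by (simp add: pq box_free_def height_def colour_def list_all_iff case_prod_unfold)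
  have u: "mixed_free fst height colour (set L) p q \<longleftrightarrow>
      list_all (\<lambda>(u, v, d). btw y v y' \<longrightarrow> (if d = c then x < u else x' < u)) L"
    by (simp add: pq mixed_free_def height_def colour_def list_all_iff case_prod_unfold)
  have r: "mixed_free height fst colour (set L) p q \<longleftrightarrow>
      list_all (\<lambda>(u, v, d). btw x u x' \<longrightarrow> (if d = c then y < v else y' < v)) L"
    by (simp add: pq mixed_free_def height_def colour_def list_all_iff case_prod_unfold)
  have c: "colour p \<longleftrightarrow> c" "colour q \<longleftrightarrow> c'" by (simp_all add: pq colour_def)
  show ?thesis unfolding mult_def b u r c by (simp add: pq of_bool_def)
qed

lemma loop_list: "loop_list L p = loop fst height (set L) p"
  by (cases p; simp add: loop_def height_def list_all_iff of_bool_def case_prod_unfold)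

text \<open>Obstructions are always tested against the fixed list \<open>L\<close> while
  \<open>ps\<close> shrinks; this separation makes the induction possible, and \<open>ps = L\<close>
  gives \<open>weight\<close>.\<close>

lemma half_weight:
  "distinct ps \<Longrightarrow> 2 * half_weight L ps =
     (\<Sum>p\<in>set ps. 2 * loop fst height (set L) p +
       (\<Sum>q\<in>set ps - {p}. mult fst height colour (set L) p q))"
proof (induction ps)
  case (Cons p ps)
  let ?m = "mult fst height colour (set L)" and ?l = "loop fst height (set L)"
  have p: "p \<notin> set ps" "distinct ps" using Cons.prems by auto
  have "(\<Sum>q\<in>set (p # ps) - {r}. ?m r q) = ?m p r + (\<Sum>q\<in>set ps - {r}. ?m r q)" if "r \<in> set ps" for r
  proof -
    have "set (p # ps) - {r} = insert p (set ps - {r})" using p that by auto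
    then show ?thesis using p mult_sym[of fst height colour "set L" r p] by simp
  qed
  then have "(\<Sum>r\<in>set ps. 2 * ?l r + (\<Sum>q\<in>set (p # ps) - {r}. ?m r q))
      = (\<Sum>r\<in>set ps. ?m p r + (2 * ?l r + (\<Sum>q\<in>set ps - {r}. ?m r q)))"
    by (intro sum.cong refl) simp
  also have "\<dots> = (\<Sum>r\<in>set ps. ?m p r) + 2 * half_weight L ps"
    unfolding Cons.IH[OF p(2)] by (rule sum.distrib)
  finally have "(\<Sum>r\<in>set ps. 2 * ?l r + (\<Sum>q\<in>set (p # ps) - {r}. ?m r q))
     = (\<Sum>r\<in>set ps. ?m p r) + 2 * half_weight L ps" .
  moreover have "set (p # ps) - {p} = set ps" using p by auto
  moreover have "sum_list (map (?m p) ps) = (\<Sum>r\<in>set ps. ?m p r)"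
    using p by (simp add: sum_list_distinct_conv_sum_set)
  ultimately show ?case using p by (simp add: loop_list mult_list[abs_def])
qed simp

text \<open>Repeated values are discarded before descending, so that the search visits about n!
  lists rather than n^n.\<close>

fun all_arrangements :: "(nat list \<Rightarrow> bool) \<Rightarrow> nat \<Rightarrow> nat \<Rightarrow> nat list \<Rightarrow> bool" where
  "all_arrangements P n 0 ys = P ys"
| "all_arrangements P n (Suc k) ys =
     list_all (\<lambda>y. if y \<in> set ys then True else all_arrangements P n k (y # ys)) [0..<n]"

text \<open>Values are prepended, so the last entry of \<open>xs\<close> is chosen first; hence the
  induction from the right.\<close>

lemma all_arrangementsD:
  "all_arrangements P n (length xs) ys \<Longrightarrow> distinct (xs @ ys) \<Longrightarrow> set xs \<subseteq> {0..<n} \<Longrightarrow> P (xs @ ys)"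
proof (induction xs arbitrary: ys rule: rev_induct)
  case (snoc x xs)
  then have "all_arrangements P n (length xs) (x # ys)" by (auto simp: list_all_iff)
  from snoc.IH[OF this] snoc.prems show ?case by auto
qed simp

text \<open>Only the relative order of the coordinates and equality of colours matter, so the leftmost
  point may be taken to have colour \<open>True\<close>.\<close>

definition small_check :: "nat \<Rightarrow> bool" where
  "small_check n \<longleftrightarrow> all_arrangements (\<lambda>ys. list_all
       (\<lambda>cs. let L = zip [0..<n] (zip ys (True # cs)) in half_weight L L \<le> 4 * (n - 1))
       (List.n_lists (n - 1) [True, False])) n n []"

lemma small_check_2: "small_check 2"
  by code_simp
lemma small_check_3: "small_check 3"
  by code_simp
lemma small_check_4: "small_check 4"
  by code_simp

lemma small_check_5: "small_check 5"
  by code_simp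

lemma rank_less_iff:
  fixes f :: "'a \<Rightarrow> 'b::linorder"
  assumes "finite V" "r \<in> V" "s \<in> V"
  shows "card {t \<in> V. f t < f r} < card {t \<in> V. f t < f s} \<longleftrightarrow> f r < f s"
proof
  assume "f r < f s"
  then have "{t \<in> V. f t < f r} \<subset> {t \<in> V. f t < f s}" using assms(2) by auto
  then show "card {t \<in> V. f t < f r} < card {t \<in> V. f t < f s}"
    using assms(1) by (intro psubset_card_mono) auto
next
  assume *: "card {t \<in> V. f t < f r} < card {t \<in> V. f t < f s}"
  show "f r < f s"
  proof (rule ccontr)
    assume "\<not> f r < f s"
    then have "{t \<in> V. f t < f s} \<subseteq> {t \<in> V. f t < f r}" by auto
    then show False using * assms(1) card_mono[of "{t \<in> V. f t < f r}"] by (simp add: not_less[symmetric])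
  qed
qed

text \<open>Ranks preserve all comparisons, and colouring relative to the leftmost point
  \<open>h 0\<close> preserves equality of colours, so \<open>weight_image\<close> moves the
  configuration to one that the check has visited.\<close>

lemma weight_le_small_check:
  fixes X :: "'a \<Rightarrow> 'b::linorder" and Y :: "'a \<Rightarrow> 'c::linorder"
  assumes check: "small_check (card V)" and ne: "card V > 0" and inj: "inj_on X V" "inj_on Y V"
  shows "weight X Y col V \<le> 8 * (card V - 1)"
proof -
  let ?n = "card V"
  have fin: "finite V" using ne by (rule card_ge_0_finite)
  define x where "x v = card {t \<in> V. X t < X v}" for v
  define y where "y v = card {t \<in> V. Y t < Y v}" for v
  have x: "x r < x s \<longleftrightarrow> X r < X s" and y: "y r < y s \<longleftrightarrow> Y r < Y s" if "r \<in> V" "s \<in> V" for r s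
    unfolding x_def y_def using rank_less_iff[OF fin that] by auto
  have injx: "inj_on x V" using inj(1) x by (intro inj_onI) (metis inj_onD linorder_neqE less_irrefl)
  have injy: "inj_on y V" using inj(2) y by (intro inj_onI) (metis inj_onD linorder_neqE less_irrefl)
  have lt: "card {t \<in> V. P t} < ?n" if "v \<in> V" "\<not> P v" for P and v
    using that fin by (intro psubset_card_mono) auto
  have x_lt: "x v < ?n" and y_lt: "y v < ?n" if "v \<in> V" for v
    unfolding x_def y_def using that by (auto intro: lt[of v])
  have "x ` V = {0..<?n}"
    using x_lt card_image[OF injx] by (intro card_subset_eq) auto
  then have bij: "bij_betw x V {0..<?n}" using injx by (simp add: bij_betw_def)
  define h where "h = inv_into V x"
  have h: "bij_betw h {0..<?n} V" unfolding h_def using bij by (rule bij_betw_inv_into)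
  have xh: "x (h i) = i" if "i < ?n" for i
    unfolding h_def using bij that by (simp add: bij_betw_inv_into_right)
  define c where "c v \<longleftrightarrow> col v = col (h 0)" for v
  define G where "G v = (x v, y v, c v)" for v
  have hV: "h i \<in> V" if "i < ?n" for i using h that by (auto simp: bij_betw_def)
  define ys where "ys = map (\<lambda>i. y (h i)) [0..<?n]"
  define cs where "cs = map (\<lambda>i. c (h i)) [1..<?n]"
  define L where "L = zip [0..<?n] (zip ys (True # cs))"
  have len: "length ys = ?n" "length cs = ?n - 1" by (simp_all add: ys_def cs_def)
  have cs: "True # cs = map (\<lambda>i. c (h i)) [0..<?n]"
    using ne by (simp add: cs_def c_def upt_conv_Cons)
  have L: "L = map (\<lambda>i. G (h i)) [0..<?n]"
    unfolding L_def ys_def cs by (rule nth_equalityI) (simp_all add: G_def xh)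
  have "h ` {0..<?n} = V" using h by (simp add: bij_betw_def)
  then have setL: "set L = G ` V" unfolding L by (simp add: image_image[symmetric])
  have "distinct ys"
    unfolding ys_def distinct_map using h injy
    by (auto intro: comp_inj_on[unfolded comp_def] simp: bij_betw_def)
  moreover have "set ys \<subseteq> {0..<?n}" using y_lt hV by (auto simp: ys_def)
  ultimately have "half_weight L L \<le> 4 * (?n - 1)"
    using all_arrangementsD[of _ ?n ys "[]"] check len
    unfolding small_check_def list_all_iff set_n_lists L_def Let_def by auto
  moreover have "distinct L" unfolding L_def by (simp add: distinct_zipI1)
  ultimately have "weight fst height colour (set L) \<le> 8 * (?n - 1)"
    using half_weight[of L L] by (simp add: weight_def deg_def algebra_simps mult_2)
  moreover have "weight fst height colour (G ` V) = weight X Y col V"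
  proof (rule weight_image)
    show "inj_on G V" using injx by (auto simp: G_def inj_on_def)
  qed (use x y in \<open>auto simp: G_def c_def height_def colour_def\<close>)
  ultimately show ?thesis by (simp add: setL)
qed

section \<open>The bound and its induction\<close>

text \<open>Both formulas give 16 at 5, so the quadratic one is available from 5 on.\<close>

definition bound :: "nat \<Rightarrow> nat" where
  "bound n = (if n \<le> 5 then 4 * (n - 1) else n\<^sup>2 div 2 + n - 1)"

lemma bound_Suc: "5 \<le> n \<Longrightarrow> bound n + Suc n \<le> bound (Suc n)"
proof -
  assume n: "5 \<le> n"
  have b: "bound m = m\<^sup>2 div 2 + m - 1" if "5 \<le> m" for m
    using that by (cases "m = 5") (simp_all add: bound_def)
  have "(Suc n)\<^sup>2 = n\<^sup>2 + 1 + 2 * n" by (simp add: power2_eq_square)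
  then have "(Suc n)\<^sup>2 div 2 \<ge> n\<^sup>2 div 2 + n" by presburger
  then show ?thesis using n b[of n] b[of "Suc n"] by simp
qed

text \<open>Deleting a pair from \<open>n + 2\<close> points costs up to \<open>2 * (n + 2)\<close>;
  the induction has no slack here.\<close>

lemma bound_Suc_Suc: "5 \<le> n \<Longrightarrow> bound n + 2 * (n + 2) = bound (n + 2)"
proof -
  assume n: "5 \<le> n"
  have b: "bound m = m\<^sup>2 div 2 + m - 1" if "5 \<le> m" for m
    using that by (cases "m = 5") (simp_all add: bound_def)
  have "(n + 2)\<^sup>2 = n\<^sup>2 + 2 * (2 * n + 2)" by (simp add: power2_eq_square algebra_simps)
  then have "(n + 2)\<^sup>2 div 2 = n\<^sup>2 div 2 + (2 * n + 2)" by presburger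
  then show ?thesis using n b[of n] b[of "n + 2"] by simp
qed

lemma weight_le:
  fixes X :: "'a \<Rightarrow> 'b::linorder" and Y :: "'a \<Rightarrow> 'c::linorder"
  assumes "inj_on X V" "inj_on Y V" "card V \<ge> 2"
  shows "weight X Y col V \<le> 2 * bound (card V)"
  using assms
proof (induction "card V" arbitrary: V rule: less_induct)
  case less
  let ?n = "card V" and ?w = "weight X Y col" and ?d = "deg X Y col V"
  have fin: "finite V" using less.prems(3) by (intro card_ge_0_finite) simp
  have IH: "?w W \<le> 2 * bound (card W)" if "W \<subset> V" "card W \<ge> 2" for W
    using that less.hyps[of W] less.prems fin by (meson inj_on_subset psubset_card_mono psubset_imp_subset)
  show ?case
  proof (cases "?n \<le> 5")
    case True
    then have "?n \<in> {2, 3, 4, 5}" using less.prems(3) by auto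
    then have "small_check ?n"
      using small_check_2 small_check_3 small_check_4 small_check_5 by auto
    then show ?thesis
      using weight_le_small_check[OF _ _ less.prems(1,2), of col] less.prems(3) True
      by (simp add: bound_def)
  next
    case False
    have del: "?w V \<le> 2 * bound (?n - 1) + 2 * ?d v" if "v \<in> V" for v
    proof -
      have "V - {v} \<subset> V" "card (V - {v}) = ?n - 1" using that fin by auto
      then have "?w (V - {v}) \<le> 2 * bound (?n - 1)" using IH[of "V - {v}"] False by simp
      then show ?thesis using weight_delete[OF fin that, of X Y col] by linarith
    qed
    have n: "5 \<le> ?n - 1" "Suc (?n - 1) = ?n" using False by linarith+
    show ?thesis
    proof (rule removable[OF fin less.prems(1,2), of col])
      show "5 \<le> ?n" using False by simp
    next
      fix v assume "v \<in> V" "?d v \<le> ?n"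
      then show ?thesis using del[of v] bound_Suc[OF n(1)] unfolding n(2) by linarith
    next
      fix u v assume uv: "u \<in> V" "v \<in> V" "u \<noteq> v" "?d u + ?d v \<le> 2 * ?n + mult X Y col V u v"
      have "V - {u, v} \<subset> V" "card (V - {u, v}) = ?n - 2" using uv fin by auto
      then have "?w (V - {u, v}) \<le> 2 * bound (?n - 2)" using IH[of "V - {u, v}"] n by simp
      then have le: "?w V \<le> 2 * bound (?n - 2) + 4 * ?n"
        using weight_delete_pair[OF fin uv(1-3), of X Y col] uv(4)
        by (simp add: algebra_simps)
      show ?thesis
      proof (cases "?n = 6")
        case False
        then have n': "5 \<le> ?n - 2" "?n - 2 + 2 = ?n" using n by linarith+
        then show ?thesis using le bound_Suc_Suc[OF n'(1)] unfolding n'(2) by linarith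
      next
        \<comment> \<open>The pair step starts from \<open>bound 4 = 12\<close>, one above the
          quadratic formula, and gives 24 where 23 is wanted.\<close>
        case True
        show ?thesis
        proof (rule ccontr)
          assume "\<not> ?thesis"
          then have big: "?w V > 46" by (simp add: True bound_def)
          have "?w V \<le> 48" using le by (simp add: True bound_def)
          \<comment> \<open>The leftmost point carries a loop, so the degrees sum to at most 48 - 1
            and one of the six is at most 7. Deleting that point leaves \<open>bound 5 = 16\<close>,
            and 16 + 7 = 23.\<close>
          obtain R where R: "R \<in> V" "\<forall>r\<in>V. X R \<le> X r"
            using ex_min_if_finite[of "X ` V"] fin uv(1) by (auto simp: not_less)
          then have "loop X Y V R = 1" by (auto simp: loop_def not_less[symmetric])
          then have "(\<Sum>v\<in>V. loop X Y V v) \<ge> 1"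
            using sum_nonneg_leq_bound member_le_sum[OF R(1), of "loop X Y V"] fin by simp
          then have "(\<Sum>v\<in>V. ?d v) < (\<Sum>v\<in>V. 8)"
            using \<open>?w V \<le> 48\<close> True by (simp add: weight_def sum.distrib)
          then obtain v where "v \<in> V" "?d v < 8" by (meson not_less sum_mono)
          then show False using del[of v] big True by (simp add: bound_def)
        qed
      qed
    qed
  qed
qed

section \<open>Bruhat covers of signed permutations\<close>

lemma signed_points_iff: "x \<in> signed_points n \<longleftrightarrow> x \<noteq> 0 \<and> \<bar>x\<bar> \<le> int n"
  by (auto simp: signed_points_def)

lemma finite_signed_points [simp]: "finite (signed_points n)"
  by (simp add: signed_points_def)

lemma uminus_signed_points [simp]: "- x \<in> signed_points n \<longleftrightarrow> x \<in> signed_points n"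
  by (simp add: signed_points_iff)

lemma signed_perms_uminus:
  assumes "w \<in> signed_perms n"
  shows "w (- i) = - w i"
proof (cases "i \<in> signed_points n")
  case False
  then have "- i \<notin> signed_points n" by simp
  then show ?thesis using False assms by (auto simp: signed_perms_def permutes_not_in)
qed (use assms in \<open>simp add: signed_perms_def\<close>)

lemma signed_perms_in_iff [simp]:
  "w \<in> signed_perms n \<Longrightarrow> w i \<in> signed_points n \<longleftrightarrow> i \<in> signed_points n"
  by (simp add: signed_perms_def permutes_in_image)

lemma signed_perms_inj: "w \<in> signed_perms n \<Longrightarrow> w i = w j \<longleftrightarrow> i = j"
  using permutes_inj[of w "signed_points n"] by (auto simp: signed_perms_def inj_eq)

lemma signed_perms_id [simp]: "id \<in> signed_perms n"
  by (simp add: signed_perms_def permutes_id)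

lemma signed_perms_comp [simp]:
  "u \<in> signed_perms n \<Longrightarrow> v \<in> signed_perms n \<Longrightarrow> u \<circ> v \<in> signed_perms n"
  using permutes_compose[of v "signed_points n" u]
  by (simp add: signed_perms_def permutes_in_image)

lemma finite_signed_perms: "finite (signed_perms n)"
  unfolding signed_perms_def using finite_permutations[OF finite_signed_points]
  by (rule rev_finite_subset) auto

text \<open>The order of the tests makes the case \<open>j = - i\<close> a plain transposition, so
  sign changes need no separate notation.\<close>

definition signed_swap :: "int \<Rightarrow> int \<Rightarrow> int \<Rightarrow> int" where
  "signed_swap i j x = (if x = i then j else if x = j then i
                 else if x = - i then - j else if x = - j then - i else x)"

lemma signed_swap_eq_transpose: "signed_swap i (- i) = transpose i (- i)"
  unfolding signed_swap_def fun_eq_iff transpose_def by simp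

lemma signed_swap_eq_comp_transpose:
  assumes "i \<noteq> 0" "j \<noteq> 0" "i \<noteq> j" "j \<noteq> - i"
  shows "signed_swap i j = transpose i j \<circ> transpose (- j) (- i)"
proof
  show "signed_swap i j x = (transpose i j \<circ> transpose (- j) (- i)) x" for x
    using assms unfolding signed_swap_def comp_apply transpose_def by smt
qed

lemma signed_swap_involutory:
  "i \<noteq> 0 \<Longrightarrow> j \<noteq> 0 \<Longrightarrow> i \<noteq> j \<Longrightarrow> signed_swap i j (signed_swap i j x) = x"
  unfolding signed_swap_def by smt

lemma comp_signed_swap_signed_swap:
  "i \<noteq> 0 \<Longrightarrow> j \<noteq> 0 \<Longrightarrow> i \<noteq> j \<Longrightarrow> w \<circ> signed_swap i j \<circ> signed_swap i j = w"
  by (simp add: fun_eq_iff signed_swap_involutory)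

lemma signed_swap_commute:
  assumes "i \<noteq> 0" "j \<noteq> 0"
  shows "signed_swap i j = signed_swap j i"
proof
  show "signed_swap i j x = signed_swap j i x" for x
    using assms unfolding signed_swap_def by smt
qed

lemma signed_swap_neg:
  assumes "i \<noteq> 0" "j \<noteq> 0" "i \<noteq> j"
  shows "signed_swap (- j) (- i) = signed_swap i j"
proof
  show "signed_swap (- j) (- i) x = signed_swap i j x" for x
    using assms unfolding signed_swap_def by smt
qed

lemma signed_swap_uminus:
  "i \<noteq> 0 \<Longrightarrow> j \<noteq> 0 \<Longrightarrow> i \<noteq> j \<Longrightarrow> signed_swap i j (- x) = - signed_swap i j x"
  unfolding signed_swap_def by smt

lemma signed_swap_in_signed_perms [simp]:
  assumes "i \<in> signed_points n" "j \<in> signed_points n" "i \<noteq> j"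
  shows "signed_swap i j \<in> signed_perms n"
proof -
  have nz: "i \<noteq> 0" "j \<noteq> 0" using assms by (auto simp: signed_points_iff)
  have "signed_swap i j permutes signed_points n"
    unfolding permutes_def
  proof (intro conjI allI impI)
    fix x assume "x \<notin> signed_points n"
    moreover have "- i \<in> signed_points n" "- j \<in> signed_points n" using assms by auto
    ultimately show "signed_swap i j x = x" using assms by (auto simp: signed_swap_def)
  next
    fix y show "\<exists>!x. signed_swap i j x = y"
      using signed_swap_involutory[OF nz assms(3)] by metis
  qed
  moreover have "signed_swap i j (- x) = - signed_swap i j x" for x
    by (rule signed_swap_uminus[OF nz assms(3)])
  ultimately show ?thesis by (simp add: signed_perms_def)
qed

lemma conjugate_signed_swap:
  assumes w: "w \<in> signed_perms n" and ij: "i \<noteq> 0" "j \<noteq> 0" "i \<noteq> j"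
  shows "w \<circ> signed_swap i j \<circ> inv w = signed_swap (w i) (w j)"
proof
  fix x
  define y where "y = inv w x"
  have y: "x = w y" "inv w x = y"
    using w unfolding y_def by (auto simp: signed_perms_def permutes_inverses)
  have sgn: "w y = - w i \<longleftrightarrow> y = - i" "w y = - w j \<longleftrightarrow> y = - j"
    using signed_perms_inj[OF w, of y "- i"] signed_perms_inj[OF w, of y "- j"]
      signed_perms_uminus[OF w, of i] signed_perms_uminus[OF w, of j] by simp_all
  have same: "w y = w i \<longleftrightarrow> y = i" "w y = w j \<longleftrightarrow> y = j" by (simp_all only: signed_perms_inj[OF w])
  have "w (signed_swap i j y) = signed_swap (w i) (w j) (w y)"
    unfolding signed_swap_def sgn same if_distrib[of w] signed_perms_uminus[OF w] by (rule refl)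
  then show "(w \<circ> signed_swap i j \<circ> inv w) x = signed_swap (w i) (w j) x"
    by (simp only: comp_apply y(2) y(1)[symmetric])
qed

lemma simple_refl_eq:
  "simple_refl 0 = signed_swap (- 1) 1" "0 < i \<Longrightarrow> simple_refl i = signed_swap (int i) (int i + 1)"
  by (auto simp: simple_refl_def signed_swap_def fun_eq_iff transpose_def)

lemma simple_refls_iff:
  "s \<in> simple_refls n \<longleftrightarrow>
     0 < n \<and> s = signed_swap (- 1) 1 \<or> (\<exists>i. 0 < i \<and> i < n \<and> s = signed_swap (int i) (int i + 1))"
proof
  assume "s \<in> simple_refls n"
  then obtain i where "i < n" "s = simple_refl i" by (auto simp: simple_refls_def)
  then show "0 < n \<and> s = signed_swap (- 1) 1 \<or> (\<exists>i. 0 < i \<and> i < n \<and> s = signed_swap (int i) (int i + 1))"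
    using simple_refl_eq by (cases "i = 0") auto
next
  assume "0 < n \<and> s = signed_swap (- 1) 1 \<or> (\<exists>i. 0 < i \<and> i < n \<and> s = signed_swap (int i) (int i + 1))"
  then show "s \<in> simple_refls n"
    unfolding simple_refls_def
  proof (elim disjE exE conjE)
    fix i assume "0 < i" "i < n" "s = signed_swap (int i) (int i + 1)"
    then show "s \<in> simple_refl ` {0..<n}" using simple_refl_eq(2)[of i] by (intro image_eqI[of _ _ i]) auto
  qed (auto simp: simple_refl_eq(1)[symmetric])
qed

text \<open>Since 0 is missing from the point set, the positions -1 and 1 are adjacent as
  well.\<close>

lemma simple_refls_elim:
  assumes "s \<in> simple_refls n"
  obtains i j where "s = signed_swap i j" "i \<in> signed_points n" "j \<in> signed_points n" "i < j"
    "\<forall>k\<in>signed_points n. \<not> (i < k \<and> k < j)" "j = - i \<or> 0 < i"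
proof -
  from assms consider "0 < n" "s = signed_swap (- 1) 1" | i where "0 < i" "i < n" "s = signed_swap (int i) (int i + 1)"
    unfolding simple_refls_iff by auto
  then show thesis
  proof cases
    case 1
    show thesis by (rule that[of "- 1" 1]) (use 1 in \<open>auto simp: signed_points_iff\<close>)
  next
    case 2
    show thesis by (rule that[of "int i" "int i + 1"]) (use 2 in \<open>auto simp: signed_points_iff\<close>)
  qed
qed

text \<open>Two representatives suffice: \<open>signed_swap (- 1) 1\<close> is conjugate to every
  sign change and \<open>signed_swap 1 2\<close> to every other reflection.\<close>

lemma reflections_eq:
  "reflections n = {signed_swap i j | i j. i \<in> signed_points n \<and> j \<in> signed_points n \<and> i \<noteq> j}"
proof (intro equalityI subsetI)
  fix t assume "t \<in> reflections n"
  then obtain w s where w: "w \<in> signed_perms n" "s \<in> simple_refls n" "t = w \<circ> s \<circ> inv w"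
    by (auto simp: reflections_def)
  obtain i j where ij: "s = signed_swap i j" "i \<in> signed_points n" "j \<in> signed_points n" "i < j"
    using w(2) by (rule simple_refls_elim)
  then have "t = signed_swap (w i) (w j)"
    using conjugate_signed_swap[OF w(1), of i j] w(3) by (auto simp: signed_points_iff)
  moreover have "w i \<noteq> w j" using ij signed_perms_inj[OF w(1)] by auto
  ultimately show "t \<in> {signed_swap i j | i j. i \<in> signed_points n \<and> j \<in> signed_points n \<and> i \<noteq> j}"
    using ij w(1) by (intro CollectI exI[of _ "w i"] exI[of _ "w j"]) auto
next
  fix t assume "t \<in> {signed_swap i j | i j. i \<in> signed_points n \<and> j \<in> signed_points n \<and> i \<noteq> j}"
  then obtain i j where t: "t = signed_swap i j" and ij: "i \<in> signed_points n" "j \<in> signed_points n" "i \<noteq> j"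
    by blast
  have to: "\<exists>g\<in>signed_perms n. g a = b \<and> (\<forall>x. x \<notin> {a, - a, b, - b} \<longrightarrow> g x = x)"
    if "a \<in> signed_points n" "b \<in> signed_points n" for a b
  proof (cases "a = b")
    case True
    then show ?thesis by (intro bexI[of _ id]) auto
  next
    case False
    then show ?thesis using that by (intro bexI[of _ "signed_swap a b"]) (auto simp: signed_swap_def)
  qed
  have n: "0 < n" using ij(1) by (auto simp: signed_points_iff)
  then have one: "1 \<in> signed_points n" by (simp add: signed_points_iff)
  show "t \<in> reflections n"
  proof (cases "j = - i")
    case True
    obtain w where w: "w \<in> signed_perms n" "w 1 = j" using to[OF one ij(2)] by blast
    then have "w (- 1) = i" using signed_perms_uminus[OF w(1), of 1] True by simp
    then have "t = w \<circ> signed_swap (- 1) 1 \<circ> inv w"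
      using conjugate_signed_swap[OF w(1), of "- 1" 1] w(2) t by simp
    moreover have "signed_swap (- 1) 1 \<in> simple_refls n" using n by (auto simp: simple_refls_iff)
    ultimately show ?thesis using w(1) by (auto simp: reflections_def)
  next
    case False
    have n2: "1 < n"
    proof (rule ccontr)
      assume "\<not> 1 < n"
      then have "\<bar>i\<bar> = 1" "\<bar>j\<bar> = 1" using ij by (auto simp: signed_points_iff)
      then show False using False ij(3) by linarith
    qed
    then have two: "2 \<in> signed_points n" by (simp add: signed_points_iff)
    \<comment> \<open>First 1 is moved to \<open>i\<close>, then the image of 2 to \<open>j\<close>;
      the second map leaves \<open>i\<close> alone because \<open>i\<close> is none of the at most
      four points that it moves.\<close>
    obtain g where g: "g \<in> signed_perms n" "g 1 = i" using to[OF one ij(1)] by blast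
    have g2: "g 2 \<in> signed_points n" using g(1) two by simp
    have gi: "g 2 \<noteq> i" "g 2 \<noteq> - i"
      using signed_perms_inj[OF g(1), of 2 1] signed_perms_inj[OF g(1), of 2 "- 1"]
        signed_perms_uminus[OF g(1), of 1] g(2) by auto
    obtain h where h: "h \<in> signed_perms n" "h (g 2) = j"
      "\<forall>x. x \<notin> {g 2, - g 2, j, - j} \<longrightarrow> h x = x" using to[OF g2 ij(2)] by blast
    have "h i = i" using h(3) gi ij(3) False by auto
    then have "(h \<circ> g) 1 = i" "(h \<circ> g) 2 = j" using g(2) h(2) by auto
    then have "t = (h \<circ> g) \<circ> signed_swap 1 2 \<circ> inv (h \<circ> g)"
      using conjugate_signed_swap[of "h \<circ> g" n 1 2] g(1) h(1) t by simp
    moreover have "signed_swap 1 2 \<in> simple_refls n"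
      using n2 unfolding simple_refls_iff by (intro disjI2 exI[of _ 1]) auto
    moreover have "h \<circ> g \<in> signed_perms n" using g(1) h(1) by simp
    ultimately show ?thesis unfolding reflections_def by blast
  qed
qed

section \<open>Coxeter length as a count of inversions\<close>

text \<open>Four times the Coxeter length: the inversions on \<open>[-n, n] - {0}\<close> are counted as ordered
  pairs, and each sign change is counted at \<open>a\<close> and at \<open>- a\<close>.\<close>

definition disorder :: "nat \<Rightarrow> (int \<Rightarrow> int) \<Rightarrow> nat" where
  "disorder n w =
     (\<Sum>a\<in>signed_points n. \<Sum>b\<in>signed_points n. of_bool ((a < b) \<noteq> (w a < w b))) +
     (\<Sum>a\<in>signed_points n. of_bool ((0 < a) \<noteq> (0 < w a)))"

lemma sum_pairs_split:
  fixes f :: "'a \<Rightarrow> 'a \<Rightarrow> nat"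
  assumes "finite S" "i \<in> S" "j \<in> S" "i \<noteq> j"
  shows "(\<Sum>a\<in>S. \<Sum>b\<in>S. f a b) = (\<Sum>a\<in>S - {i, j}. \<Sum>b\<in>S - {i, j}. f a b) +
           (\<Sum>k\<in>S - {i, j}. f i k + f k i + (f j k + f k j)) + (f i i + f i j + (f j i + f j j))"
proof -
  let ?K = "S - {i, j}"
  have split: "(\<Sum>a\<in>S. g a) = (\<Sum>a\<in>?K. g a) + (g i + g j)" for g :: "'a \<Rightarrow> nat"
  proof -
    have "S = insert i (insert j ?K)" using assms by auto
    moreover have "finite ?K" using assms by auto
    ultimately have "(\<Sum>a\<in>S. g a) = (\<Sum>a\<in>insert i (insert j ?K). g a)" by simp
    then show ?thesis using assms by simp
  qed
  show ?thesis unfolding split sum.distrib by simp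
qed

text \<open>Only injectivity and nonzero values are assumed, because a reflection is applied as two
  transpositions and the map in between is not odd. The exchanged pair gives 2, a point of the open
  rectangle changes its relation to both corners in both orders, and the number of wrong signs grows
  only if the rectangle contains the origin.\<close>

lemma disorder_transpose:
  assumes inj: "inj_on u (signed_points n)" and nz: "\<And>a. a \<in> signed_points n \<Longrightarrow> u a \<noteq> 0"
    and ij: "i \<in> signed_points n" "j \<in> signed_points n" "i < j" "u i < u j"
  shows "disorder n (u \<circ> transpose i j) =
           disorder n u + 2 + 4 * card {k \<in> signed_points n. i < k \<and> k < j \<and> u i < u k \<and> u k < u j}
           + 2 * of_bool (i < 0 \<and> 0 < j \<and> u i < 0 \<and> 0 < u j)"
proof -
  let ?S = "signed_points n" and ?v = "u \<circ> transpose i j"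
  let ?K = "?S - {i, j}"
  let ?B = "\<lambda>k. i < k \<and> k < j \<and> u i < u k \<and> u k < u j"
  define f where "f w a b = (of_bool ((a < b) \<noteq> (w a < w b)) :: nat)" for w :: "int \<Rightarrow> int" and a b
  define g where "g w a = (of_bool ((0 < a) \<noteq> (0 < w a)) :: nat)" for w :: "int \<Rightarrow> int" and a
  have dis: "disorder n w = (\<Sum>a\<in>?S. \<Sum>b\<in>?S. f w a b) + (\<Sum>a\<in>?S. g w a)" for w
    by (simp add: disorder_def f_def g_def)
  have ne: "i \<noteq> j" using ij by simp
  have v: "?v i = u j" "?v j = u i" "\<And>k. k \<in> ?K \<Longrightarrow> ?v k = u k"
    by (auto simp: transpose_def)
  have KK: "(\<Sum>a\<in>?K. \<Sum>b\<in>?K. f ?v a b) = (\<Sum>a\<in>?K. \<Sum>b\<in>?K. f u a b)"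
    by (intro sum.cong refl) (simp add: f_def v(3))
  have k: "f ?v i k + f ?v k i + (f ?v j k + f ?v k j) = (f u i k + f u k i + (f u j k + f u k j)) + 4 * of_bool (?B k)"
    if "k \<in> ?K" for k
  proof -
    have "u k \<noteq> u i" "u k \<noteq> u j" "k \<noteq> i" "k \<noteq> j" using that inj ij by (auto dest: inj_onD)
    then have "i < k \<longleftrightarrow> \<not> k < i" "j < k \<longleftrightarrow> \<not> k < j" "u i < u k \<longleftrightarrow> \<not> u k < u i" "u j < u k \<longleftrightarrow> \<not> u k < u j"
      "k < i \<Longrightarrow> k < j" "u k < u i \<Longrightarrow> u k < u j"
      using ij(3,4) by linarith+
    then show ?thesis unfolding f_def v(1,2) v(3)[OF that]
      by (cases "k < i"; cases "k < j"; cases "u k < u i"; cases "u k < u j"; simp)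
  qed
  have e1: "(\<Sum>k\<in>?K. f ?v i k + f ?v k i + (f ?v j k + f ?v k j))
      = (\<Sum>k\<in>?K. f u i k + f u k i + (f u j k + f u k j)) + 4 * (\<Sum>k\<in>?K. of_bool (?B k))"
    using k unfolding sum_distrib_left sum.distrib[symmetric] by (intro sum.cong refl) simp
  have e2: "(\<Sum>k\<in>?K. of_bool (?B k) :: nat) = card {k \<in> ?S. ?B k}"
  proof -
    have "(\<Sum>k\<in>?K. of_bool (?B k) :: nat) = card (?K \<inter> {k. ?B k})"
      by (simp add: of_bool_def sum.If_cases)
    also have "?K \<inter> {k. ?B k} = {k \<in> ?S. ?B k}" by auto
    finally show ?thesis .
  qed
  have e3: "f ?v i i + f ?v i j + (f ?v j i + f ?v j j) = f u i i + f u i j + (f u j i + f u j j) + 2"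
    using ij(3,4) unfolding f_def v(1,2) by simp
  have e4: "(\<Sum>a\<in>?S. g ?v a) = (\<Sum>a\<in>?S. g u a) + 2 * of_bool (i < 0 \<and> 0 < j \<and> u i < 0 \<and> 0 < u j)"
  proof -
    have split: "(\<Sum>a\<in>?S. h a) = (\<Sum>a\<in>?K. h a) + (h i + h j)" for h :: "int \<Rightarrow> nat"
    proof -
      have "?S = insert i (insert j ?K)" using ij by auto
      then have "(\<Sum>a\<in>?S. h a) = (\<Sum>a\<in>insert i (insert j ?K). h a)" by simp
      then show ?thesis using ne by simp
    qed
    have "(\<Sum>a\<in>?K. g ?v a) = (\<Sum>a\<in>?K. g u a)"
      by (intro sum.cong refl) (simp add: g_def v(3))
    moreover have "g ?v i + g ?v j = g u i + g u j + 2 * of_bool (i < 0 \<and> 0 < j \<and> u i < 0 \<and> 0 < u j)"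
    proof -
      have "i \<noteq> 0" "j \<noteq> 0" "u i \<noteq> 0" "u j \<noteq> 0" using ij nz by (auto simp: signed_points_iff)
      then have "i < 0 \<longleftrightarrow> \<not> 0 < i" "u i < 0 \<longleftrightarrow> \<not> 0 < u i" "0 < i \<Longrightarrow> 0 < j" "0 < u i \<Longrightarrow> 0 < u j"
        using ij(3,4) by linarith+
      then show ?thesis unfolding g_def v(1,2)
        by (cases "0 < i"; cases "0 < j"; cases "0 < u i"; cases "0 < u j"; simp)
    qed
    ultimately show ?thesis unfolding split by simp
  qed
  show ?thesis
    unfolding dis sum_pairs_split[OF finite_signed_points ij(1,2) ne] KK e1 e2 e3 e4
    by (simp only: ac_simps)
qed

text \<open>Using \<open>btw\<close> leaves open which value is larger, so one predicate serves
  covers in both directions. The pair \<open>j = - i\<close> is exempt from the origin condition, as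
  its rectangle always contains the origin.\<close>

definition good_pair :: "nat \<Rightarrow> (int \<Rightarrow> int) \<Rightarrow> int \<Rightarrow> int \<Rightarrow> bool" where
  "good_pair n u i j \<longleftrightarrow> (j = - i \<or> \<not> (btw i 0 j \<and> btw (u i) 0 (u j))) \<and>
     (\<forall>k\<in>signed_points n. btw i k j \<longrightarrow> \<not> btw (u i) (u k) (u j))"

lemma signed_perms_nonzero: "u \<in> signed_perms n \<Longrightarrow> a \<in> signed_points n \<Longrightarrow> u a \<noteq> 0"
  using signed_perms_in_iff[of u n a] by (auto simp: signed_points_iff)

lemma signed_perms_inj_on: "u \<in> signed_perms n \<Longrightarrow> inj_on u A"
  using signed_perms_inj by (auto simp: inj_on_def)

text \<open>A single transposition gives 2; the two signs that become wrong give the other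
  2.\<close>

lemma disorder_signed_swap_central:
  assumes u: "u \<in> signed_perms n" and j: "j \<in> signed_points n" "0 < j" "0 < u j"
  shows "disorder n (u \<circ> signed_swap (- j) j) = disorder n u + 4 +
    4 * card {k \<in> signed_points n. - j < k \<and> k < j \<and> - u j < u k \<and> u k < u j}"
proof -
  have un: "u (- j) = - u j" by (rule signed_perms_uminus[OF u])
  have eq: "signed_swap (- j) j = transpose (- j) j"
    using signed_swap_eq_transpose[of "- j"] by simp
  have "disorder n (u \<circ> transpose (- j) j) = disorder n u + 2 +
      4 * card {k \<in> signed_points n. - j < k \<and> k < j \<and> u (- j) < u k \<and> u k < u j} +
      2 * of_bool (- j < 0 \<and> 0 < j \<and> u (- j) < 0 \<and> 0 < u j)"
    by (rule disorder_transpose[OF signed_perms_inj_on[OF u] signed_perms_nonzero[OF u]])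
      (use j un in auto)
  then show ?thesis using j un eq by simp
qed

lemma disorder_signed_swap:
  assumes u: "u \<in> signed_perms n" and ij: "i \<in> signed_points n" "j \<in> signed_points n"
    "i < j" "u i < u j" "j \<noteq> - i"
  shows "disorder n u + 4 \<le> disorder n (u \<circ> signed_swap i j)"
    and "good_pair n u i j \<Longrightarrow> disorder n (u \<circ> signed_swap i j) = disorder n u + 4"
proof -
  let ?S = "signed_points n" and ?v = "u \<circ> transpose i j"
  have nz: "i \<noteq> 0" "j \<noteq> 0" "i \<noteq> j" using ij by (auto simp: signed_points_iff)
  have un: "u (- x) = - u x" for x by (rule signed_perms_uminus[OF u])
  have eq: "u \<circ> signed_swap i j = ?v \<circ> transpose (- j) (- i)"
    by (simp add: signed_swap_eq_comp_transpose[OF nz ij(5)] comp_assoc)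
  have ne: "- i \<noteq> i" "- i \<noteq> j" "- j \<noteq> i" "- j \<noteq> j" using nz ij(5) by linarith+
  have v: "?v (- i) = - u i" "?v (- j) = - u j" "?v i = u j" "?v j = u i"
    using ne by (simp_all add: un)
  have vk: "?v k = u k" if "k \<noteq> i" "k \<noteq> j" for k using that by simp
  have vinj: "inj_on ?v ?S"
    by (rule inj_on_subset[OF _ subset_UNIV], rule inj_compose)
      (auto intro!: signed_perms_inj_on[OF u])
  have vnz: "?v a \<noteq> 0" if "a \<in> ?S" for a
    using that ij signed_perms_nonzero[OF u] by (auto simp: transpose_def)
  define c1 where "c1 = card {k \<in> ?S. i < k \<and> k < j \<and> u i < u k \<and> u k < u j}"
  define c2 where "c2 = card {k \<in> ?S. - j < k \<and> k < - i \<and> - u j < ?v k \<and> ?v k < - u i}"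
  define b1 where "b1 \<longleftrightarrow> i < 0 \<and> 0 < j \<and> u i < 0 \<and> 0 < u j"
  define b2 where "b2 \<longleftrightarrow> - j < 0 \<and> 0 < - i \<and> ?v (- j) < 0 \<and> 0 < ?v (- i)"
  have d1: "disorder n ?v = disorder n u + 2 + 4 * c1 + 2 * of_bool b1"
    unfolding c1_def b1_def
    by (rule disorder_transpose[OF signed_perms_inj_on[OF u] signed_perms_nonzero[OF u]]) (use ij in auto)
  have d2: "disorder n (?v \<circ> transpose (- j) (- i)) = disorder n ?v + 2 + 4 * c2 + 2 * of_bool b2"
    unfolding c2_def b2_def v(1)[symmetric] v(2)[symmetric]
    by (rule disorder_transpose[OF vinj vnz]) (use ij v in auto)
  show "disorder n u + 4 \<le> disorder n (u \<circ> signed_swap i j)"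
    unfolding eq d2 d1 by simp
  assume g: "good_pair n u i j"
  have free: "\<not> (i < k \<and> k < j \<and> u i < u k \<and> u k < u j)" if "k \<in> ?S" for k
    using g that by (auto simp: good_pair_def btw_def)
  have nc: "\<not> (i < 0 \<and> 0 < j \<and> u i < 0 \<and> 0 < u j)"
    using g ij(5) by (auto simp: good_pair_def btw_def)
  have "c1 = 0" unfolding c1_def using free by auto
  moreover have "\<not> b1" using nc by (simp add: b1_def)
  moreover have "\<not> b2" using nc unfolding b2_def v by linarith
  \<comment> \<open>The second rectangle is the negative of the first, so a point in it other than
    \<open>i\<close> and \<open>j\<close> reflects to a point in the first. The exchanged points
    \<open>i\<close> and \<open>j\<close> could lie in it only if the first rectangle contained the
    origin.\<close>
  moreover have "\<not> (- j < k \<and> k < - i \<and> - u j < ?v k \<and> ?v k < - u i)" if k: "k \<in> ?S" for k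
  proof (cases "k = i \<or> k = j")
    case True
    then show ?thesis
    proof
      assume "k = i"
      then show ?thesis unfolding \<open>k = i\<close> v using nc ij(3,4) by linarith
    next
      assume "k = j"
      then show ?thesis unfolding \<open>k = j\<close> v using nc ij(3,4) by linarith
    qed
  next
    case False
    then show ?thesis using free[of "- k"] k un[of k] vk[of k] by auto
  qed
  then have "c2 = 0" unfolding c2_def by auto
  ultimately show "disorder n (u \<circ> signed_swap i j) = disorder n u + 4"
    unfolding eq d2 d1 by simp
qed

lemma disorder_rise:
  assumes u: "u \<in> signed_perms n" and ij: "i \<in> signed_points n" "j \<in> signed_points n" "i < j" "u i < u j"
  shows "disorder n u + 4 \<le> disorder n (u \<circ> signed_swap i j)"
    and "good_pair n u i j \<Longrightarrow> disorder n (u \<circ> signed_swap i j) = disorder n u + 4"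
proof -
  have "disorder n u + 4 \<le> disorder n (u \<circ> signed_swap i j) \<and>
    (good_pair n u i j \<longrightarrow> disorder n (u \<circ> signed_swap i j) = disorder n u + 4)"
  proof (cases "j = - i")
    case False
    then show ?thesis using disorder_signed_swap[OF u ij] by blast
  next
    case True
    then have i: "i = - j" by simp
    have j: "0 < j" "0 < u j" using ij(3,4) signed_perms_uminus[OF u, of j] unfolding i by auto
    have "card {k \<in> signed_points n. - j < k \<and> k < j \<and> - u j < u k \<and> u k < u j} = 0" if "good_pair n u i j"
    proof -
      have "\<not> (- j < k \<and> k < j \<and> - u j < u k \<and> u k < u j)" if "k \<in> signed_points n" for k
        using \<open>good_pair n u i j\<close> that signed_perms_uminus[OF u, of j]
        unfolding i good_pair_def btw_def by auto
      then show ?thesis by auto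
    qed
    then show ?thesis using disorder_signed_swap_central[OF u ij(2) j] unfolding i by auto
  qed
  then show "disorder n u + 4 \<le> disorder n (u \<circ> signed_swap i j)"
    "good_pair n u i j \<Longrightarrow> disorder n (u \<circ> signed_swap i j) = disorder n u + 4" by blast+
qed

lemma disorder_id: "disorder n id = 0"
  by (simp add: disorder_def)

lemma disorder_fall:
  assumes w: "w \<in> signed_perms n" and ij: "i \<in> signed_points n" "j \<in> signed_points n" "i < j" "w j < w i"
  shows "disorder n (w \<circ> signed_swap i j) + 4 \<le> disorder n w"
    and "good_pair n (w \<circ> signed_swap i j) i j \<Longrightarrow> disorder n w = disorder n (w \<circ> signed_swap i j) + 4"
proof -
  let ?v = "w \<circ> signed_swap i j"
  have nz: "i \<noteq> 0" "j \<noteq> 0" "i \<noteq> j" using ij by (auto simp: signed_points_iff)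
  have v: "?v \<in> signed_perms n" using w ij nz by simp
  have "?v i = w j" "?v j = w i" using nz by (auto simp: signed_swap_def)
  then have lt: "?v i < ?v j" using ij by simp
  have vv: "?v \<circ> signed_swap i j = w" by (rule comp_signed_swap_signed_swap[OF nz])
  show "disorder n ?v + 4 \<le> disorder n w"
    "good_pair n ?v i j \<Longrightarrow> disorder n w = disorder n ?v + 4"
    using disorder_rise[OF v ij(1,2,3) lt] unfolding vv by blast+
qed

lemma disorder_simple:
  assumes w: "w \<in> signed_perms n" and s: "s \<in> simple_refls n"
  shows "w \<circ> s \<in> signed_perms n" "disorder n (w \<circ> s) \<le> disorder n w + 4"
proof -
  obtain i j where ij: "s = signed_swap i j" "i \<in> signed_points n" "j \<in> signed_points n" "i < j"
    "\<forall>k\<in>signed_points n. \<not> (i < k \<and> k < j)" "j = - i \<or> 0 < i"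
    using s by (rule simple_refls_elim)
  show "w \<circ> s \<in> signed_perms n" using w ij by simp
  have good: "good_pair n u i j" for u
    using ij(4-6) by (auto simp: good_pair_def btw_def)
  have "w i \<noteq> w j" using signed_perms_inj[OF w] ij(4) by simp
  then consider "w i < w j" | "w j < w i" by linarith
  then show "disorder n (w \<circ> s) \<le> disorder n w + 4"
  proof cases
    case 1
    then show ?thesis using disorder_rise(2)[OF w ij(2-4) 1 good] ij(1) by simp
  next
    case 2
    then show ?thesis using disorder_fall(1)[OF w ij(2-4) 2] ij(1) by simp
  qed
qed

lemma foldr_comp_append: "foldr (\<circ>) (xs @ ys) id = foldr (\<circ>) xs id \<circ> foldr (\<circ>) ys id"
  by (induction xs) (auto simp: comp_assoc)

lemma foldr_comp_snoc: "foldr (\<circ>) (xs @ [x]) id = foldr (\<circ>) xs id \<circ> x"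
  unfolding foldr_comp_append by simp

lemma disorder_word:
  assumes "set ss \<subseteq> simple_refls n"
  shows "foldr (\<circ>) ss id \<in> signed_perms n \<and> disorder n (foldr (\<circ>) ss id) \<le> 4 * length ss"
  using assms
proof (induction ss rule: rev_induct)
  case Nil
  have "foldr (\<circ>) [] id = (id :: int \<Rightarrow> int)" by simp
  then show ?case by (metis disorder_id signed_perms_id le0)
next
  case (snoc s ss)
  define w where "w = foldr (\<circ>) ss id"
  have "w \<in> signed_perms n \<and> disorder n w \<le> 4 * length ss"
    unfolding w_def by (rule snoc.IH) (use snoc.prems in simp)
  then have IH: "w \<in> signed_perms n" "disorder n w \<le> 4 * length ss" by blast+
  have s: "s \<in> simple_refls n" using snoc.prems by simp
  show ?case
    unfolding foldr_comp_snoc w_def[symmetric] using disorder_simple[OF IH(1) s] IH(2) by (simp del: o_apply)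
qed

text \<open>Climbing from a positive value at 1 gives \<open>int k \<le> w (int k)\<close>;
  descending from the value at \<open>n\<close>, which is at most \<open>n\<close>, gives the
  reverse inequality.\<close>

lemma signed_perms_eq_id:
  assumes w: "w \<in> signed_perms n" and pos: "0 < n \<Longrightarrow> 0 < w 1"
    and rise: "\<And>i. 0 < i \<Longrightarrow> i < n \<Longrightarrow> w (int i) < w (int i + 1)"
  shows "w = id"
proof -
  have ge: "int k \<le> w (int k)" if "0 < k" "k \<le> n" for k
    using that
  proof (induction k)
    case (Suc k)
    then show ?case using pos rise[of k] by (cases "k = 0") (auto simp: add.commute)
  qed simp
  have le: "w (int (n - k)) \<le> int (n - k)" if "k < n" for k
    using that
  proof (induction k)
    case 0
    then have "int n \<in> signed_points n" by (simp add: signed_points_iff)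
    then have "w (int n) \<in> signed_points n" using w by (simp only: signed_perms_in_iff)
    then show ?case unfolding signed_points_iff by (auto dest: abs_le_D1)
  next
    case (Suc k)
    have "int (n - Suc k) + 1 = int (n - k)" using Suc.prems by simp
    then show ?case using Suc rise[of "n - Suc k"] by simp
  qed
  have posid: "w (int k) = int k" if "0 < k" "k \<le> n" for k
    using ge[OF that] le[of "n - k"] that by simp
  show "w = id"
  proof
    fix x
    show "w x = id x"
    proof (cases "x \<in> signed_points n")
      case False
      then show ?thesis using w by (auto simp: signed_perms_def permutes_not_in)
    next
      case True
      then have "w (int (nat \<bar>x\<bar>)) = int (nat \<bar>x\<bar>)"
        by (intro posid) (auto simp: signed_points_iff)
      then show ?thesis using signed_perms_uminus[OF w, of x] by (cases "0 \<le> x") auto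
    qed
  qed
qed

text \<open>This is sorting: a signed permutation other than \<open>id\<close> has a descent at a
  simple pair, and undoing it lowers \<open>disorder\<close> by exactly 4.\<close>

lemma word_exists:
  "w \<in> signed_perms n \<Longrightarrow>
     \<exists>ss. set ss \<subseteq> simple_refls n \<and> foldr (\<circ>) ss id = w \<and> 4 * length ss = disorder n w"
proof (induction "disorder n w" arbitrary: w rule: less_induct)
  case less
  note w = less.prems
  have step: ?case if s: "s \<in> simple_refls n" and ij: "s = signed_swap i j" "i \<in> signed_points n" "j \<in> signed_points n"
    "i < j" "w j < w i" and good: "\<And>u. good_pair n u i j" for s i j
  proof -
    have nz: "i \<noteq> 0" "j \<noteq> 0" "i \<noteq> j" using ij by (auto simp: signed_points_iff)
    have d: "disorder n w = disorder n (w \<circ> s) + 4"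
      using disorder_fall(2)[OF w ij(2-5) good] ij(1) by simp
    have ws: "w \<circ> s \<in> signed_perms n" using disorder_simple(1)[OF w s] .
    obtain ss where ss: "set ss \<subseteq> simple_refls n" "foldr (\<circ>) ss id = w \<circ> s" "4 * length ss = disorder n (w \<circ> s)"
      using less.hyps[OF _ ws] d by auto
    have "foldr (\<circ>) (ss @ [s]) id = w"
      unfolding foldr_comp_snoc ss(2) ij(1) by (rule comp_signed_swap_signed_swap[OF nz])
    then show ?case using ss s d by (intro exI[of _ "ss @ [s]"]) auto
  qed
  show ?case
  proof (cases "(0 < n \<longrightarrow> 0 < w 1) \<and> (\<forall>i. 0 < i \<longrightarrow> i < n \<longrightarrow> w (int i) < w (int i + 1))")
    case True
    then have "w = id" using signed_perms_eq_id[OF w] by blast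
    then show ?thesis by (intro exI[of _ "[]"]) (simp add: disorder_id)
  next
    case False
    then consider "0 < n" "\<not> 0 < w 1" | i where "0 < i" "i < n" "\<not> w (int i) < w (int i + 1)" by blast
    then show ?thesis
    proof cases
      case 1
      have pt: "1 \<in> signed_points n" using 1 by (simp add: signed_points_iff)
      show ?thesis
      proof (rule step[of "signed_swap (- 1) 1" "- 1" 1])
        show "signed_swap (- 1) 1 \<in> simple_refls n" using 1 by (simp add: simple_refls_iff)
        show "w 1 < w (- 1)"
          using 1 signed_perms_nonzero[OF w pt] signed_perms_uminus[OF w, of 1] by linarith
        show "good_pair n u (- 1) 1" for u by (auto simp: good_pair_def btw_def signed_points_iff)
      qed (use pt in auto)
    next
      case 2
      show ?thesis
      proof (rule step[of "signed_swap (int i) (int i + 1)" "int i" "int i + 1"])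
        show "signed_swap (int i) (int i + 1) \<in> simple_refls n" using 2 by (auto simp: simple_refls_iff)
        show "w (int i + 1) < w (int i)"
          using 2 signed_perms_inj[OF w, of "int i" "int i + 1"] by linarith
        show "good_pair n u (int i) (int i + 1)" for u using 2 by (auto simp: good_pair_def btw_def)
      qed (use 2 in \<open>auto simp: signed_points_iff\<close>)
    qed
  qed
qed

lemma cox_length_eq:
  assumes "w \<in> signed_perms n"
  shows "4 * cox_length n w = disorder n w"
proof -
  obtain ss where ss: "set ss \<subseteq> simple_refls n" "foldr (\<circ>) ss id = w" "4 * length ss = disorder n w"
    using word_exists[OF assms] by blast
  have "cox_length n w = length ss"
    unfolding cox_length_def
  proof (rule Least_equality)
    show "\<exists>ss'. set ss' \<subseteq> simple_refls n \<and> length ss' = length ss \<and> foldr (\<circ>) ss' id = w"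
      using ss by blast
  next
    fix k assume "\<exists>ss'. set ss' \<subseteq> simple_refls n \<and> length ss' = k \<and> foldr (\<circ>) ss' id = w"
    then obtain ss' where ss': "set ss' \<subseteq> simple_refls n" "length ss' = k" "foldr (\<circ>) ss' id = w" by blast
    show "length ss \<le> k" using disorder_word[OF ss'(1)] ss' ss(3) by simp
  qed
  then show ?thesis using ss(3) by simp
qed

section \<open>Bruhat order and its covers\<close>

lemma bruhat_step_iff:
  "(u, v) \<in> bruhat_step n \<longleftrightarrow> u \<in> signed_perms n \<and>
     (\<exists>i\<in>signed_points n. \<exists>j\<in>signed_points n. i < j \<and> u i < u j \<and> v = u \<circ> signed_swap i j)"
proof
  assume "(u, v) \<in> bruhat_step n"
  then obtain t where t: "u \<in> signed_perms n" "v \<in> signed_perms n" "t \<in> reflections n" "v = u \<circ> t"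
    "cox_length n u < cox_length n v" by (auto simp: bruhat_step_def)
  then have lt: "disorder n u < disorder n v" using cox_length_eq[of u n] cox_length_eq[of v n] by linarith
  obtain a b where ab: "t = signed_swap a b" "a \<in> signed_points n" "b \<in> signed_points n" "a \<noteq> b"
    using t(3) unfolding reflections_eq by blast
  obtain i j where ij: "t = signed_swap i j" "i \<in> signed_points n" "j \<in> signed_points n" "i < j"
  proof (cases "a < b")
    case True
    then show thesis using that ab by blast
  next
    case False
    have "a \<noteq> 0" "b \<noteq> 0" using ab by (auto simp: signed_points_iff)
    then have "t = signed_swap b a" using ab(1) signed_swap_commute by simp
    then show thesis using that[of b a] ab False by simp
  qed
  have "\<not> u j < u i" using disorder_fall(1)[OF t(1) ij(2-4)] lt t(4) ij(1) by auto
  then have "u i < u j" using signed_perms_inj[OF t(1), of i j] ij(4) by linarith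
  then show "u \<in> signed_perms n \<and>
     (\<exists>i\<in>signed_points n. \<exists>j\<in>signed_points n. i < j \<and> u i < u j \<and> v = u \<circ> signed_swap i j)"
    using t ij by blast
next
  assume "u \<in> signed_perms n \<and>
     (\<exists>i\<in>signed_points n. \<exists>j\<in>signed_points n. i < j \<and> u i < u j \<and> v = u \<circ> signed_swap i j)"
  then obtain i j where u: "u \<in> signed_perms n" and ij: "i \<in> signed_points n" "j \<in> signed_points n"
    "i < j" "u i < u j" "v = u \<circ> signed_swap i j" by blast
  have v: "v \<in> signed_perms n" using u ij by simp
  have "cox_length n u < cox_length n v"
    using disorder_rise(1)[OF u ij(1-4)] cox_length_eq[OF u] cox_length_eq[OF v] ij(5) by simp
  moreover have "signed_swap i j \<in> reflections n" using ij unfolding reflections_eq by blast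
  ultimately show "(u, v) \<in> bruhat_step n" using u v ij(5) by (auto simp: bruhat_step_def)
qed

lemma bruhat_stepI:
  "u \<in> signed_perms n \<Longrightarrow> i \<in> signed_points n \<Longrightarrow> j \<in> signed_points n \<Longrightarrow> i < j \<Longrightarrow> u i < u j \<Longrightarrow>
     (u, u \<circ> signed_swap i j) \<in> bruhat_step n"
  unfolding bruhat_step_iff by blast

lemma bruhat_step_disorder: "(u, v) \<in> bruhat_step n \<Longrightarrow> disorder n u + 4 \<le> disorder n v"
  unfolding bruhat_step_iff using disorder_rise(1) by blast

lemma bruhat_le_disorder: "bruhat_le n u v \<Longrightarrow> u = v \<or> disorder n u + 4 \<le> disorder n v"
  unfolding bruhat_le_def
  by (induction rule: rtrancl_induct) (use bruhat_step_disorder in fastforce)+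

text \<open>Consequently a relation that raises \<open>disorder\<close> by exactly 4 cannot be
  refined.\<close>

lemma bruhat_less_disorder: "bruhat_less n u v \<Longrightarrow> disorder n u + 4 \<le> disorder n v"
  unfolding bruhat_less_def using bruhat_le_disorder by blast

lemma bruhat_step_less: "(u, v) \<in> bruhat_step n \<Longrightarrow> bruhat_less n u v"
  using bruhat_step_disorder[of u v n] by (auto simp: bruhat_less_def bruhat_le_def)

lemma bruhat_less_trans: "bruhat_less n u v \<Longrightarrow> bruhat_less n v w \<Longrightarrow> bruhat_less n u w"
  using bruhat_less_disorder[of n u v] bruhat_less_disorder[of n v w]
  by (auto simp: bruhat_less_def bruhat_le_def)

text \<open>The first step of a chain from \<open>u\<close> to \<open>v\<close> would otherwise end
  strictly between them.\<close>

lemma bruhat_covers_step: "bruhat_covers n v u \<Longrightarrow> (u, v) \<in> bruhat_step n"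
proof -
  assume c: "bruhat_covers n v u"
  then have "(u, v) \<in> (bruhat_step n)\<^sup>*" "u \<noteq> v"
    by (auto simp: bruhat_covers_def bruhat_less_def bruhat_le_def)
  then obtain x where x: "(u, x) \<in> bruhat_step n" "(x, v) \<in> (bruhat_step n)\<^sup>*"
    by (metis converse_rtranclE)
  have "x = v"
  proof (rule ccontr)
    assume "x \<noteq> v"
    then have "bruhat_less n x v" using x(2) by (simp add: bruhat_less_def bruhat_le_def)
    moreover have "x \<in> signed_perms n" using x(1) by (auto simp: bruhat_step_def)
    ultimately show False using c bruhat_step_less[OF x(1)] by (auto simp: bruhat_covers_def)
  qed
  then show ?thesis using x(1) by simp
qed

lemma signed_swap_eval:
  assumes "i \<noteq> 0" "j \<noteq> 0" "i \<noteq> j"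
  shows "signed_swap i j i = j" "signed_swap i j j = i"
    "signed_swap i j (- i) = - j" "signed_swap i j (- j) = - i"
    "x \<noteq> i \<Longrightarrow> x \<noteq> j \<Longrightarrow> x \<noteq> - i \<Longrightarrow> x \<noteq> - j \<Longrightarrow> signed_swap i j x = x"
  using assms by (auto simp: signed_swap_def)

text \<open>Between two signed permutations whose windows on three positions read \<open>abc\<close> and \<open>cba\<close>
  with \<open>a < b < c\<close>, the Bruhat order passes through \<open>bac\<close> and \<open>cab\<close>.\<close>

lemma not_covers_box:
  assumes u: "u \<in> signed_perms n"
    and pts: "i \<in> signed_points n" "k \<in> signed_points n" "j \<in> signed_points n"
    and pos: "i < k" "k < j" and val: "u i < u k" "u k < u j"
    and ne: "j \<noteq> - i" "k \<noteq> - i" "k \<noteq> - j"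
  shows "\<not> bruhat_covers n (u \<circ> signed_swap i j) u"
proof
  assume c: "bruhat_covers n (u \<circ> signed_swap i j) u"
  have nz: "i \<noteq> 0" "j \<noteq> 0" "k \<noteq> 0" "i \<noteq> j" "i \<noteq> k" "k \<noteq> j" using pts pos by (auto simp: signed_points_iff)
  define x where "x = u \<circ> signed_swap i k"
  define y where "y = x \<circ> signed_swap i j"
  define z where "z = y \<circ> signed_swap k j"
  have ev: "signed_swap i k i = k" "signed_swap i k k = i" "signed_swap i k j = j"
    "signed_swap i j i = j" "signed_swap i j j = i" "signed_swap i j k = k"
    using nz ne by (auto intro!: signed_swap_eval)
  have x: "x \<in> signed_perms n" unfolding x_def using u pts nz by simp
  have y: "y \<in> signed_perms n" unfolding y_def using x pts nz by simp
  have xv: "x i = u k" "x k = u i" "x j = u j" by (simp_all add: x_def ev)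
  have yv: "y i = u j" "y k = u i" "y j = u k" by (simp_all add: y_def ev xv)
  have ux: "(u, x) \<in> bruhat_step n" unfolding x_def using u pts pos val by (intro bruhat_stepI) auto
  have xy: "(x, y) \<in> bruhat_step n" unfolding y_def using x pts pos val xv by (intro bruhat_stepI) auto
  have yz: "(y, z) \<in> bruhat_step n" unfolding z_def using y pts pos val yv by (intro bruhat_stepI) auto
  have "z = u \<circ> signed_swap i j"
  proof
    fix a
    let ?f = "\<lambda>a. signed_swap i k (signed_swap i j (signed_swap k j a))"
    have ev': "signed_swap k j i = i" "signed_swap k j j = k" "signed_swap k j k = j"
      using nz ne by (auto intro!: signed_swap_eval)
    have minus: "?f (- b) = - ?f b" for b using nz by (simp add: signed_swap_uminus)
    have base: "?f b = signed_swap i j b" if "b \<in> {i, j, k}" for b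
      using that by (auto simp: ev ev')
    have "?f a = signed_swap i j a"
    proof (cases "a \<in> {i, j, k} \<or> - a \<in> {i, j, k}")
      case True
      then show ?thesis
      proof
        assume "- a \<in> {i, j, k}"
        then show ?thesis using base[of "- a"] minus[of a] signed_swap_uminus[of i j a] nz by simp
      qed (rule base)
    next
      case False
      then have "a \<noteq> i" "a \<noteq> j" "a \<noteq> k" "a \<noteq> - i" "a \<noteq> - j" "a \<noteq> - k" by auto
      then show ?thesis by (simp add: signed_swap_def)
    qed
    then show "z a = (u \<circ> signed_swap i j) a" by (simp add: z_def y_def x_def)
  qed
  then have "bruhat_less n x (u \<circ> signed_swap i j)"
    using bruhat_less_trans[OF bruhat_step_less[OF xy] bruhat_step_less[OF yz]] by simp
  then show False using c x bruhat_step_less[OF ux] by (auto simp: bruhat_covers_def)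
qed

text \<open>For \<open>0 < p < q\<close> the window \<open>[A, B]\<close> climbs through \<open>[- A, B]\<close> and \<open>[B, - A]\<close>
  to \<open>[- B, - A]\<close>.\<close>

lemma not_covers_central:
  assumes u: "u \<in> signed_perms n" and pts: "p \<in> signed_points n" "q \<in> signed_points n"
    and pos: "0 < p" "p < q" and val: "0 < u p" "0 < u q"
  shows "\<not> bruhat_covers n (u \<circ> signed_swap (- p) q) u"
proof
  assume c: "bruhat_covers n (u \<circ> signed_swap (- p) q) u"
  define x where "x = u \<circ> signed_swap (- p) p"
  define y where "y = x \<circ> signed_swap p q"
  define z where "z = y \<circ> signed_swap (- p) p"
  have un: "u (- a) = - u a" for a by (rule signed_perms_uminus[OF u])
  have ev: "signed_swap (- p) p p = - p" "signed_swap (- p) p (- p) = p" "signed_swap (- p) p q = q"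
    "signed_swap (- p) p (- q) = - q" "signed_swap p q p = q" "signed_swap p q (- p) = - q" "signed_swap p q q = p"
    using pos by (auto simp: signed_swap_def)
  have x: "x \<in> signed_perms n" unfolding x_def using u pts pos by simp
  have y: "y \<in> signed_perms n" unfolding y_def using x pts pos by simp
  have xv: "x p = - u p" "x q = u q" "x (- q) = - u q" by (simp_all add: x_def ev un)
  have yv: "y p = u q" "y (- p) = - u q" by (simp_all add: y_def ev xv)
  have ux: "(u, x) \<in> bruhat_step n" unfolding x_def using u pts pos val un by (intro bruhat_stepI) auto
  have xy: "(x, y) \<in> bruhat_step n" unfolding y_def using x pts pos val xv by (intro bruhat_stepI) auto
  have yz: "(y, z) \<in> bruhat_step n" unfolding z_def using y pts pos val yv by (intro bruhat_stepI) auto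
  have "z = u \<circ> signed_swap (- p) q"
  proof
    fix a
    have "signed_swap (- p) p (signed_swap p q (signed_swap (- p) p a)) = signed_swap (- p) q a"
      using pos unfolding signed_swap_def by smt
    then show "z a = (u \<circ> signed_swap (- p) q) a" by (simp add: z_def y_def x_def)
  qed
  then have "bruhat_less n x (u \<circ> signed_swap (- p) q)"
    using bruhat_less_trans[OF bruhat_step_less[OF xy] bruhat_step_less[OF yz]] by simp
  then show False using c x bruhat_step_less[OF ux] by (auto simp: bruhat_covers_def)
qed

text \<open>For \<open>0 < k < j\<close> the window \<open>[c, D]\<close> with \<open>\<bar>c\<bar> < D\<close> climbs through \<open>[D, c]\<close> and
  \<open>[- D, c]\<close> to \<open>[c, - D]\<close>.\<close>

lemma not_covers_symmetric:
  assumes u: "u \<in> signed_perms n" and pts: "k \<in> signed_points n" "j \<in> signed_points n"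
    and pos: "0 < k" "k < j" and val: "- u j < u k" "u k < u j"
  shows "\<not> bruhat_covers n (u \<circ> signed_swap (- j) j) u"
proof
  assume c: "bruhat_covers n (u \<circ> signed_swap (- j) j) u"
  define x where "x = u \<circ> signed_swap k j"
  define y where "y = x \<circ> signed_swap (- k) k"
  define z where "z = y \<circ> signed_swap k j"
  have un: "u (- a) = - u a" for a by (rule signed_perms_uminus[OF u])
  have ev: "signed_swap k j k = j" "signed_swap k j j = k" "signed_swap k j (- k) = - j"
    "signed_swap (- k) k k = - k" "signed_swap (- k) k j = j"
    using pos by (auto simp: signed_swap_def)
  have x: "x \<in> signed_perms n" unfolding x_def using u pts pos by simp
  have y: "y \<in> signed_perms n" unfolding y_def using x pts pos by simp
  have xv: "x k = u j" "x j = u k" "x (- k) = - u j" by (simp_all add: x_def ev un)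
  have yv: "y k = - u j" "y j = u k" by (simp_all add: y_def ev xv)
  have ux: "(u, x) \<in> bruhat_step n" unfolding x_def using u pts pos val by (intro bruhat_stepI) auto
  have xy: "(x, y) \<in> bruhat_step n" unfolding y_def using x pts pos val xv by (intro bruhat_stepI) auto
  have yz: "(y, z) \<in> bruhat_step n" unfolding z_def using y pts pos val yv by (intro bruhat_stepI) auto
  have "z = u \<circ> signed_swap (- j) j"
  proof
    fix a
    have "signed_swap k j (signed_swap (- k) k (signed_swap k j a)) = signed_swap (- j) j a"
      using pos unfolding signed_swap_def by smt
    then show "z a = (u \<circ> signed_swap (- j) j) a" by (simp add: z_def y_def x_def)
  qed
  then have "bruhat_less n x (u \<circ> signed_swap (- j) j)"
    using bruhat_less_trans[OF bruhat_step_less[OF xy] bruhat_step_less[OF yz]] by simp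
  then show False using c x bruhat_step_less[OF ux] by (auto simp: bruhat_covers_def)
qed

text \<open>A good pair raises the length by exactly one. A pair that is not good admits one of
  three refinements: the symmetric one for \<open>j = - i\<close>, the central one if the rectangle
  contains the origin, and the box otherwise.\<close>

lemma bruhat_covers_iff:
  "bruhat_covers n v u \<longleftrightarrow> u \<in> signed_perms n \<and>
     (\<exists>i\<in>signed_points n. \<exists>j\<in>signed_points n.
        i < j \<and> u i < u j \<and> good_pair n u i j \<and> v = u \<circ> signed_swap i j)"
proof
  assume c: "bruhat_covers n v u"
  obtain i j where u: "u \<in> signed_perms n" and ij: "i \<in> signed_points n" "j \<in> signed_points n"
    "i < j" "u i < u j" "v = u \<circ> signed_swap i j"
    using bruhat_covers_step[OF c] unfolding bruhat_step_iff by blast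
  have un: "u (- a) = - u a" for a by (rule signed_perms_uminus[OF u])
  have nz: "i \<noteq> 0" "j \<noteq> 0" "i \<noteq> j" using ij by (auto simp: signed_points_iff)
  have btwi: "btw i x j \<longleftrightarrow> i < x \<and> x < j" "btw (u i) x (u j) \<longleftrightarrow> u i < x \<and> x < u j" for x
    using ij(3,4) by (auto simp: btw_def)
  have "good_pair n u i j"
  proof (rule ccontr)
    assume ng: "\<not> good_pair n u i j"
    show False
    proof (cases "j = - i")
      case True
      then have i: "i = - j" by simp
      obtain k where "k \<in> signed_points n" "i < k" "k < j" "u i < u k" "u k < u j"
        using ng True unfolding good_pair_def btwi by auto
      then have k: "k \<in> signed_points n" "- j < k" "k < j" "- u j < u k" "u k < u j"
        using i un[of j] by simp_all
      have nk: "k \<noteq> 0" using k(1) by (simp add: signed_points_iff)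
      have cv: "bruhat_covers n (u \<circ> signed_swap (- j) j) u" using c ij(5) i by simp
      show False
      proof (cases "0 < k")
        case True
        then show False using not_covers_symmetric[OF u k(1) ij(2) _ k(3-5)] cv by blast
      next
        \<comment> \<open>The symmetric rectangle contains the negative of every obstruction, so a
          positive one may be used.\<close>
        case False
        then have "0 < - k" "- k < j" "- u j < u (- k)" "u (- k) < u j" using k nk un[of k] by auto
        then show False using not_covers_symmetric[OF u _ ij(2), of "- k"] k(1) cv by simp
      qed
    next
      case False
      show False
      proof (cases "i < 0 \<and> 0 < j \<and> u i < 0 \<and> 0 < u j")
        case True
        then have pos: "0 < u (- i)" using un[of i] by simp
        show False
        proof (cases "- i < j")
          case True
          then show False
            using not_covers_central[OF u _ ij(2), of "- i"] ij(1,5) \<open>i < 0 \<and> _\<close> pos c by simp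
        next
          case False
          then have "j < - i" using \<open>j \<noteq> - i\<close> by linarith
          then show False
            using not_covers_central[OF u ij(2), of "- i"] ij(1,5) \<open>i < 0 \<and> _\<close> pos c
              signed_swap_neg[OF nz] by simp
        qed
      next
        case noncentral: False
        then obtain k where k: "k \<in> signed_points n" "i < k" "k < j" "u i < u k" "u k < u j"
          using ng False unfolding good_pair_def btwi by auto
        \<comment> \<open>A negated corner inside the rectangle would bring the origin with
          it.\<close>
        have "k \<noteq> - i" using noncentral k un[of i] by auto
        moreover have "k \<noteq> - j" using noncentral k un[of j] by auto
        ultimately show False
          using not_covers_box[OF u ij(1) k(1) ij(2) k(2-5) False] c ij(5) by blast
      qed
    qed
  qed
  then show "u \<in> signed_perms n \<and>
     (\<exists>i\<in>signed_points n. \<exists>j\<in>signed_points n.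
        i < j \<and> u i < u j \<and> good_pair n u i j \<and> v = u \<circ> signed_swap i j)"
    using u ij by blast
next
  assume "u \<in> signed_perms n \<and>
     (\<exists>i\<in>signed_points n. \<exists>j\<in>signed_points n.
        i < j \<and> u i < u j \<and> good_pair n u i j \<and> v = u \<circ> signed_swap i j)"
  then obtain i j where u: "u \<in> signed_perms n" and ij: "i \<in> signed_points n" "j \<in> signed_points n"
    "i < j" "u i < u j" "good_pair n u i j" "v = u \<circ> signed_swap i j" by blast
  have d: "disorder n v = disorder n u + 4"
    unfolding ij(6) by (rule disorder_rise(2)[OF u ij(1-5)])
  have "bruhat_less n u v" unfolding ij(6) by (rule bruhat_step_less[OF bruhat_stepI[OF u ij(1-4)]])
  moreover have False if "bruhat_less n u x" "bruhat_less n x v" for x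
    using bruhat_less_disorder[OF that(1)] bruhat_less_disorder[OF that(2)] d by simp
  ultimately show "bruhat_covers n v u" by (auto simp: bruhat_covers_def)
qed

lemma good_pair_uminus:
  assumes u: "u \<in> signed_perms n" and g: "good_pair n u i j"
  shows "good_pair n u (- j) (- i)"
proof -
  have un: "u (- a) = - u a" for a by (rule signed_perms_uminus[OF u])
  have b: "btw (- y) x (- z) \<longleftrightarrow> btw z (- x) y" for x y z :: int by (auto simp: btw_def)
  have "\<not> btw (u i) (u (- k)) (u j)" if "k \<in> signed_points n" "btw i (- k) j" for k
    using g that unfolding good_pair_def by simp
  moreover have "j = - i \<or> \<not> (btw i 0 j \<and> btw (u i) 0 (u j))" using g by (simp add: good_pair_def)
  ultimately show ?thesis unfolding good_pair_def un b by (auto simp: un)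
qed

text \<open>The reflection only permutes the corners of the rectangle and of its negative; all other
  values stay. Hence the elements covered by \<open>p\<close> can be read off the good pairs of
  \<open>p\<close> itself, just like those covering it.\<close>

lemma good_pair_comp_signed_swap:
  assumes u: "u \<in> signed_perms n" and ij: "i \<noteq> 0" "j \<noteq> 0" "i \<noteq> j" and g: "good_pair n u i j"
  shows "good_pair n (u \<circ> signed_swap i j) i j"
proof -
  let ?v = "u \<circ> signed_swap i j"
  have un: "u (- a) = - u a" for a by (rule signed_perms_uminus[OF u])
  have v: "?v i = u j" "?v j = u i" "?v (- i) = - u j" "?v (- j) = - u i"
    using ij by (simp_all add: signed_swap_eval un)
  have nc: "j = - i \<or> \<not> (btw i 0 j \<and> btw (u j) 0 (u i))"
    using g by (simp add: good_pair_def btw_sym[of "u j"])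
  have "\<not> btw (u j) (?v k) (u i)" if k: "k \<in> signed_points n" "btw i k j" for k
  proof
    assume b: "btw (u j) (?v k) (u i)"
    have nij: "k \<noteq> i" "k \<noteq> j" using k(2) by (auto simp: btw_def)
    show False
    proof (cases "k = - i \<or> k = - j")
      case True
      then have "j \<noteq> - i" using nij by auto
      moreover have "btw i 0 j" using True k(2) ij by (auto simp: btw_def)
      moreover have "btw (u j) 0 (u i)" using True b v by (auto simp: btw_def)
      ultimately show False using nc by blast
    next
      case False
      then have "?v k = u k" using nij ij by (simp add: signed_swap_eval)
      then show False using g k b by (auto simp: good_pair_def btw_sym[of "u j"])
    qed
  qed
  then show ?thesis unfolding good_pair_def v using nc by blast
qed

section \<open>From covers to coloured points\<close>

text \<open>The pairs \<open>(i, j)\<close> and \<open>(- j, - i)\<close> define the same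
  reflection; the condition \<open>- j \<le> i\<close> keeps one of them.\<close>

definition good_pairs :: "nat \<Rightarrow> (int \<Rightarrow> int) \<Rightarrow> (int \<times> int) set" where
  "good_pairs n p = {(i, j). i \<in> signed_points n \<and> j \<in> signed_points n \<and> - j \<le> i \<and> i < j \<and> good_pair n p i j}"

lemma inj_on_good_pairs:
  assumes p: "p \<in> signed_perms n"
  shows "inj_on (\<lambda>(i, j). p \<circ> signed_swap i j) (good_pairs n p)"
proof -
  have bounds: "i \<noteq> 0" "- j \<le> i" "i < j" if "(i, j) \<in> good_pairs n p" for i j
    using that unfolding good_pairs_def by (simp_all add: signed_points_iff)
  have top: "signed_swap i j j = i" for i j
    by (simp add: signed_swap_def)
  \<comment> \<open>Among the points moved by \<open>signed_swap i j\<close> the largest is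
    \<open>j\<close>, and \<open>i\<close> is its image, so the pair can be recovered.\<close>
  have le: "j' \<le> j" if r: "(i, j) \<in> good_pairs n p" "(i', j') \<in> good_pairs n p"
    and s: "signed_swap i j = signed_swap i' j'" for i j i' j'
  proof (rule ccontr)
    assume "\<not> j' \<le> j"
    then have "j' \<noteq> i" "j' \<noteq> j" "j' \<noteq> - i" "j' \<noteq> - j" using bounds[OF r(1)] by linarith+
    then have "signed_swap i j j' = j'" by (simp add: signed_swap_def)
    then show False using s top[of i' j'] bounds(3)[OF r(2)] by simp
  qed
  show ?thesis
  proof (rule inj_onI)
    fix x y
    assume xy: "x \<in> good_pairs n p" "y \<in> good_pairs n p"
      and eq: "(case x of (i, j) \<Rightarrow> p \<circ> signed_swap i j) = (case y of (i, j) \<Rightarrow> p \<circ> signed_swap i j)"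
    obtain i j i' j' where x: "x = (i, j)" and y: "y = (i', j')" by (metis surj_pair)
    have r: "(i, j) \<in> good_pairs n p" "(i', j') \<in> good_pairs n p" using xy x y by simp_all
    have s: "signed_swap i j = signed_swap i' j'"
    proof
      fix a
      have "p (signed_swap i j a) = p (signed_swap i' j' a)"
        using fun_cong[OF eq, of a] x y by simp
      then show "signed_swap i j a = signed_swap i' j' a" by (simp only: signed_perms_inj[OF p])
    qed
    have j: "j = j'" using le[OF r s] le[OF r(2,1) s[symmetric]] by simp
    have "signed_swap i' j' j = i" using fun_cong[OF s[symmetric], of j] by (simp only: top)
    then have "i' = i" by (simp only: j top)
    then show "x = y" using x y j by simp
  qed
qed

lemma total_degree_eq:
  assumes p: "p \<in> signed_perms n"
  shows "total_degree n p = card (good_pairs n p)"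
proof -
  have "{q \<in> signed_perms n. bruhat_covers n q p \<or> bruhat_covers n p q}
      = (\<lambda>(i, j). p \<circ> signed_swap i j) ` good_pairs n p" (is "?L = ?R")
  proof (intro equalityI subsetI)
    fix q assume q: "q \<in> ?L"
    obtain i j where ij: "i \<in> signed_points n" "j \<in> signed_points n" "i < j" "good_pair n p i j"
      "q = p \<circ> signed_swap i j"
    proof (cases "bruhat_covers n q p")
      case True
      then show thesis using that unfolding bruhat_covers_iff by blast
    next
      case False
      then obtain i j where qq: "q \<in> signed_perms n" "i \<in> signed_points n" "j \<in> signed_points n" "i < j"
        "good_pair n q i j" "p = q \<circ> signed_swap i j" using q unfolding bruhat_covers_iff by blast
      then have nz: "i \<noteq> 0" "j \<noteq> 0" "i \<noteq> j" by (auto simp: signed_points_iff)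
      show thesis
      proof (rule that[OF qq(2-4)])
        show "good_pair n p i j" using good_pair_comp_signed_swap[OF qq(1) nz qq(5)] qq(6) by simp
        show "q = p \<circ> signed_swap i j" unfolding qq(6) by (rule comp_signed_swap_signed_swap[OF nz, symmetric])
      qed
    qed
    have nz: "i \<noteq> 0" "j \<noteq> 0" "i \<noteq> j" using ij by (auto simp: signed_points_iff)
    show "q \<in> ?R"
    proof (cases "- j \<le> i")
      case True
      then have "(i, j) \<in> good_pairs n p" using ij by (auto simp: good_pairs_def)
      then show ?thesis using ij(5) by force
    next
      case False
      then have "(- j, - i) \<in> good_pairs n p"
        using ij good_pair_uminus[OF p ij(4)] by (auto simp: good_pairs_def)
      moreover have "q = p \<circ> signed_swap (- j) (- i)" using ij(5) signed_swap_neg[OF nz] by simp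
      ultimately show ?thesis by force
    qed
  next
    fix q assume "q \<in> ?R"
    then obtain i j where ij: "i \<in> signed_points n" "j \<in> signed_points n" "i < j" "good_pair n p i j"
      and q: "q = p \<circ> signed_swap i j" by (auto simp: good_pairs_def)
    then have nz: "i \<noteq> 0" "j \<noteq> 0" "i \<noteq> j" by (auto simp: signed_points_iff)
    have qs: "q \<in> signed_perms n" using p q ij nz by simp
    have qv: "q i = p j" "q j = p i" using q nz by (simp_all add: signed_swap_eval)
    have "p i \<noteq> p j" using signed_perms_inj[OF p] nz by simp
    then consider "p i < p j" | "q i < q j" using qv by linarith
    then show "q \<in> ?L"
    proof cases
      case 1
      then show ?thesis using p q qs ij unfolding bruhat_covers_iff by blast
    next
      case 2
      have "good_pair n q i j" using good_pair_comp_signed_swap[OF p nz ij(4)] q by simp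
      moreover have "p = q \<circ> signed_swap i j" unfolding q by (rule comp_signed_swap_signed_swap[OF nz, symmetric])
      ultimately show ?thesis using 2 qs ij unfolding bruhat_covers_iff by blast
    qed
  qed
  then show ?thesis
    unfolding total_degree_def using card_image[OF inj_on_good_pairs[OF p]] by simp
qed

lemma btw_same_sign:
  fixes a b c :: int
  assumes "a \<noteq> 0" "b \<noteq> 0" "c \<noteq> 0" "0 < a \<longleftrightarrow> 0 < c"
  shows "btw a b c \<longleftrightarrow> (0 < b \<longleftrightarrow> 0 < a) \<and> btw \<bar>a\<bar> \<bar>b\<bar> \<bar>c\<bar>"
  using assms unfolding btw_def by presburger

lemma btw_opposite_sign:
  fixes a b c :: int
  assumes "a \<noteq> 0" "b \<noteq> 0" "c \<noteq> 0" "0 < a \<longleftrightarrow> \<not> 0 < c"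
  shows "btw a b c \<longleftrightarrow> (if 0 < b \<longleftrightarrow> 0 < a then \<bar>b\<bar> < \<bar>a\<bar> else \<bar>b\<bar> < \<bar>c\<bar>)"
  using assms unfolding btw_def by presburger

lemma sum_symmetric_pairs:
  fixes f :: "'a::linorder \<Rightarrow> 'a \<Rightarrow> nat"
  assumes fin: "finite V" and sym: "\<And>i j. f i j = f j i"
  shows "(\<Sum>j\<in>V. \<Sum>i\<in>V - {j}. f j i) = 2 * (\<Sum>j\<in>V. \<Sum>i\<in>{i \<in> V. i < j}. f i j)"
proof -
  have "(\<Sum>i\<in>V - {j}. f j i) = (\<Sum>i\<in>{i \<in> V. i < j}. f i j) + (\<Sum>i\<in>{i \<in> V. j < i}. f j i)" for j
  proof -
    have eq: "V - {j} = {i \<in> V. i < j} \<union> {i \<in> V. j < i}" by auto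
    have "finite {i \<in> V. i < j}" "finite {i \<in> V. j < i}" using fin by simp_all
    moreover have "{i \<in> V. i < j} \<inter> {i \<in> V. j < i} = {}" by auto
    ultimately have "(\<Sum>i\<in>V - {j}. f j i) = (\<Sum>i\<in>{i \<in> V. i < j}. f j i) + (\<Sum>i\<in>{i \<in> V. j < i}. f j i)"
      unfolding eq by (rule sum.union_disjoint)
    moreover have "(\<Sum>i\<in>{i \<in> V. i < j}. f j i) = (\<Sum>i\<in>{i \<in> V. i < j}. f i j)"
      by (rule sum.cong[OF refl sym])
    ultimately show ?thesis by simp
  qed
  then have "(\<Sum>j\<in>V. \<Sum>i\<in>V - {j}. f j i) =
      (\<Sum>j\<in>V. \<Sum>i\<in>{i \<in> V. i < j}. f i j) + (\<Sum>j\<in>V. \<Sum>i\<in>{i \<in> V. j < i}. f j i)"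
    by (simp only: sum.distrib)
  moreover have "(\<Sum>j\<in>V. \<Sum>i\<in>{i \<in> V. j < i}. f j i) = (\<Sum>j\<in>V. \<Sum>i\<in>{i \<in> V. i < j}. f i j)"
    by (rule sum.swap_restrict[OF fin fin])
  ultimately show ?thesis by simp
qed

context
  fixes n :: nat and p :: "int \<Rightarrow> int"
  assumes p: "p \<in> signed_perms n"
begin

lemma p_abs_inj: "0 < k \<Longrightarrow> 0 < j \<Longrightarrow> \<bar>p k\<bar> = \<bar>p j\<bar> \<Longrightarrow> k = j"
proof -
  assume kj: "0 < k" "0 < j" "\<bar>p k\<bar> = \<bar>p j\<bar>"
  then have "p k = p j \<or> p k = p (- j)" using signed_perms_uminus[OF p, of j] by linarith
  then show "k = j" using signed_perms_inj[OF p] kj by auto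
qed

text \<open>The rectangle of \<open>- j\<close> and \<open>j\<close> is invariant under negation, so
  its emptiness can be tested on positive positions and absolute values.\<close>

lemma loop_eq_good_pair:
  assumes "j \<in> {1..int n}"
  shows "loop (\<lambda>i. i) (\<lambda>i. \<bar>p i\<bar>) {1..int n} j = of_bool (good_pair n p (- j) j)"
proof -
  have pj: "p (- j) = - p j" by (rule signed_perms_uminus[OF p])
  have "good_pair n p (- j) j \<longleftrightarrow> (\<forall>k\<in>signed_points n. btw (- j) k j \<longrightarrow> \<not> btw (- p j) (p k) (p j))"
    by (simp add: good_pair_def pj)
  also have "\<dots> \<longleftrightarrow> (\<forall>k\<in>signed_points n. \<bar>k\<bar> < j \<longrightarrow> \<not> \<bar>p k\<bar> < \<bar>p j\<bar>)"
    using assms by (intro ball_cong refl) (auto simp: btw_def)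
  also have "\<dots> \<longleftrightarrow> (\<forall>k\<in>{1..int n}. k < j \<longrightarrow> \<not> \<bar>p k\<bar> < \<bar>p j\<bar>)"
  proof (intro iffI ballI impI)
    fix k assume a: "\<forall>k\<in>{1..int n}. k < j \<longrightarrow> \<not> \<bar>p k\<bar> < \<bar>p j\<bar>" and k: "k \<in> signed_points n" "\<bar>k\<bar> < j"
    have "\<bar>k\<bar> \<in> {1..int n}" using k(1) by (auto simp: signed_points_iff)
    moreover have "\<bar>p \<bar>k\<bar>\<bar> = \<bar>p k\<bar>" using signed_perms_uminus[OF p, of k] by (cases "0 \<le> k") auto
    ultimately show "\<not> \<bar>p k\<bar> < \<bar>p j\<bar>" using a k(2) by metis
  next
    fix k assume a: "\<forall>k\<in>signed_points n. \<bar>k\<bar> < j \<longrightarrow> \<not> \<bar>p k\<bar> < \<bar>p j\<bar>" and k: "k \<in> {1..int n}" "k < j"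
    then show "\<not> \<bar>p k\<bar> < \<bar>p j\<bar>" by (auto simp: signed_points_iff)
  qed
  finally show ?thesis by (simp add: loop_def)
qed

text \<open>Equal signs put the origin into the rectangle of \<open>- i\<close> and
  \<open>j\<close>, so at most one edge is left. For opposite signs the rectangle of
  \<open>i\<close> and \<open>j\<close> crosses the horizontal axis and that of \<open>- i\<close>
  and \<open>j\<close> the vertical one, whence the two conditions with exchanged
  coordinates.\<close>

lemma mult_eq_good_pair:
  assumes i: "0 < i" and ij: "i < j" and j: "j \<le> int n"
  shows "mult (\<lambda>i. i) (\<lambda>i. \<bar>p i\<bar>) (\<lambda>i. 0 < p i) {1..int n} i j =
    of_bool (good_pair n p i j) + of_bool (good_pair n p (- i) j)"
proof -
  let ?S = "signed_points n" and ?V = "{1..int n}"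
  have un: "p (- a) = - p a" for a by (rule signed_perms_uminus[OF p])
  have nz: "p k \<noteq> 0" if "k \<in> ?S" for k using that by (rule signed_perms_nonzero[OF p])
  have pts: "i \<in> ?S" "j \<in> ?S" "i \<in> ?V" "j \<in> ?V" using assms by (auto simp: signed_points_iff)
  have VS: "k \<in> ?S" "- k \<in> ?S" if "k \<in> ?V" for k using that by (auto simp: signed_points_iff)
  have pos: "good_pair n p i j \<longleftrightarrow> (\<forall>k\<in>?V. btw i k j \<longrightarrow> \<not> btw (p i) (p k) (p j))"
  proof -
    have "\<not> btw i 0 j" using i ij by (auto simp: btw_def)
    moreover have "k \<in> ?V" if "k \<in> ?S" "btw i k j" for k
      using that i ij j by (auto simp: btw_def signed_points_iff)
    ultimately show ?thesis using VS unfolding good_pair_def by blast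
  qed
  show ?thesis
  proof (cases "0 < p i \<longleftrightarrow> 0 < p j")
    case True
    have "\<not> good_pair n p (- i) j"
    proof -
      have "btw (- i) 0 j" using i ij by (auto simp: btw_def)
      moreover have "btw (p (- i)) 0 (p j)" unfolding un using True nz[OF pts(1)] nz[OF pts(2)]
        unfolding btw_def by linarith
      ultimately show ?thesis using ij by (simp add: good_pair_def)
    qed
    moreover have "good_pair n p i j \<longleftrightarrow> box_free (\<lambda>i. i) (\<lambda>i. \<bar>p i\<bar>) (\<lambda>i. 0 < p i) ?V i j"
      unfolding pos box_free_def using btw_same_sign[OF nz[OF pts(1)] nz[OF VS(1)] nz[OF pts(2)] True]
      by blast
    ultimately show ?thesis using True by (simp add: mult_def)
  next
    case False
    have "good_pair n p i j \<longleftrightarrow> mixed_free (\<lambda>i. \<bar>p i\<bar>) (\<lambda>i. i) (\<lambda>i. 0 < p i) ?V i j"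
      unfolding pos mixed_free_def
    proof (intro ball_cong refl imp_cong)
      fix k assume k: "k \<in> ?V" "btw i k j"
      then have "k \<noteq> i" "k \<noteq> j" by (auto simp: btw_def)
      then have ne: "\<bar>p k\<bar> \<noteq> \<bar>p i\<bar>" "\<bar>p k\<bar> \<noteq> \<bar>p j\<bar>"
        using p_abs_inj[of k i] p_abs_inj[of k j] k(1) i ij by auto
      have b: "btw (p i) (p k) (p j) \<longleftrightarrow> (if (0 < p k) = (0 < p i) then \<bar>p k\<bar> < \<bar>p i\<bar> else \<bar>p k\<bar> < \<bar>p j\<bar>)"
        by (rule btw_opposite_sign) (use nz pts VS k False in auto)
      show "(\<not> btw (p i) (p k) (p j)) = (if (0 < p k) = (0 < p i) then \<bar>p i\<bar> < \<bar>p k\<bar> else \<bar>p j\<bar> < \<bar>p k\<bar>)"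
      proof -
        have "\<not> \<bar>p k\<bar> < \<bar>p i\<bar> \<longleftrightarrow> \<bar>p i\<bar> < \<bar>p k\<bar>" "\<not> \<bar>p k\<bar> < \<bar>p j\<bar> \<longleftrightarrow> \<bar>p j\<bar> < \<bar>p k\<bar>"
          using ne by linarith+
        then show ?thesis unfolding b by (cases "(0 < p k) = (0 < p i)") (simp_all only: if_True if_False simp_thms)
      qed
    qed
    moreover have "good_pair n p (- i) j \<longleftrightarrow> mixed_free (\<lambda>i. i) (\<lambda>i. \<bar>p i\<bar>) (\<lambda>i. 0 < p i) ?V i j"
    proof -
      have s: "0 < - p i \<longleftrightarrow> 0 < p j" and mi: "- p i \<noteq> 0"
        using False nz[OF pts(1)] nz[OF pts(2)] by linarith+
      have nc: "\<not> btw (- p i) 0 (p j)" using s mi nz[OF pts(2)] by (auto simp: btw_def)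
      have b: "btw (- p i) (p k) (p j) \<longleftrightarrow> ((0 < p k) = (0 < - p i)) \<and> btw \<bar>p i\<bar> \<bar>p k\<bar> \<bar>p j\<bar>"
        if "k \<in> ?S" for k
        using btw_same_sign[OF mi nz[OF that] nz[OF pts(2)] s] by simp
      have g: "good_pair n p (- i) j \<longleftrightarrow> (\<forall>k\<in>?S. - i < k \<and> k < j \<longrightarrow> \<not> btw (- p i) (p k) (p j))"
        using nc i ij unfolding good_pair_def un by (auto simp: btw_def)
      show ?thesis
      proof
        assume gp: "good_pair n p (- i) j"
        show "mixed_free (\<lambda>i. i) (\<lambda>i. \<bar>p i\<bar>) (\<lambda>i. 0 < p i) ?V i j"
          unfolding mixed_free_def
        proof (intro ballI impI)
          fix r assume r: "r \<in> ?V" "btw \<bar>p i\<bar> \<bar>p r\<bar> \<bar>p j\<bar>"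
          have rne: "r \<noteq> i" "r \<noteq> j" using r(2) by (auto simp: btw_def)
          show "if (0 < p r) = (0 < p i) then i < r else j < r"
          proof (cases "(0 < p r) = (0 < p i)")
            \<comment> \<open>For a point coloured like \<open>i\<close> it is the negative
              \<open>- r\<close> whose value has the sign of \<open>p j\<close> and which may
              obstruct.\<close>
            case True
            then have "(0 < p (- r)) = (0 < - p i)" "\<bar>p (- r)\<bar> = \<bar>p r\<bar>"
              using un[of r] nz[OF VS(1)[OF r(1)]] nz[OF pts(1)] by auto
            then have "btw (- p i) (p (- r)) (p j)" using b[OF VS(2)[OF r(1)]] r(2) by simp
            then have "\<not> (- i < - r \<and> - r < j)" using gp VS(2)[OF r(1)] unfolding g by blast
            then show ?thesis using True rne r(1) i ij by auto
          next
            case False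
            then have "(0 < p r) = (0 < - p i)" using nz[OF VS(1)[OF r(1)]] nz[OF pts(1)] by auto
            then have "btw (- p i) (p r) (p j)" using b[OF VS(1)[OF r(1)]] r(2) by simp
            then have "\<not> (- i < r \<and> r < j)" using gp VS(1)[OF r(1)] unfolding g by blast
            then show ?thesis using False rne r(1) i ij by auto
          qed
        qed
      next
        assume mf: "mixed_free (\<lambda>i. i) (\<lambda>i. \<bar>p i\<bar>) (\<lambda>i. 0 < p i) ?V i j"
        show "good_pair n p (- i) j"
          unfolding g
        proof (intro ballI impI notI)
          fix k assume k: "k \<in> ?S" "- i < k \<and> k < j" "btw (- p i) (p k) (p j)"
          have kb: "(0 < p k) = (0 < - p i)" "btw \<bar>p i\<bar> \<bar>p k\<bar> \<bar>p j\<bar>" using k(3) b[OF k(1)] by auto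
          show False
          proof (cases "0 < k")
            case True
            then have kV: "k \<in> ?V" using k(1) by (auto simp: signed_points_iff)
            have "(0 < p k) \<noteq> (0 < p i)" using kb(1) mi by auto
            moreover have "if (0 < p k) = (0 < p i) then i < k else j < k"
              using mf kV kb(2) unfolding mixed_free_def by blast
            ultimately show False using k(2) by simp
          next
            case False
            then have kV: "- k \<in> ?V" using k(1) by (auto simp: signed_points_iff)
            have "(0 < p (- k)) = (0 < p i)" "\<bar>p (- k)\<bar> = \<bar>p k\<bar>"
              using kb(1) mi un[of k] nz[OF k(1)] by auto
            moreover have "if (0 < p (- k)) = (0 < p i) then i < - k else j < - k"
              using mf kV kb(2) calculation(2) unfolding mixed_free_def by metis
            ultimately show False using k(2) by simp
          qed
        qed
      qed
    qed
    ultimately show ?thesis using False by (simp add: mult_def)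
  qed
qed

lemma card_good_pairs:
  "2 * card (good_pairs n p) = weight (\<lambda>i. i) (\<lambda>i. \<bar>p i\<bar>) (\<lambda>i. 0 < p i) {1..int n}"
proof -
  let ?V = "{1..int n}"
  let ?m = "mult (\<lambda>i. i) (\<lambda>i. \<bar>p i\<bar>) (\<lambda>i. 0 < p i) ?V" and ?l = "loop (\<lambda>i. i) (\<lambda>i. \<bar>p i\<bar>) ?V"
  define A where "A j = {i \<in> signed_points n. - j \<le> i \<and> i < j \<and> good_pair n p i j}" for j
  have "good_pairs n p = prod.swap ` (SIGMA j:?V. A j)"
    by (force simp: good_pairs_def A_def signed_points_iff)
  then have "card (good_pairs n p) = card (SIGMA j:?V. A j)"
    by (simp add: card_image)
  also have "\<dots> = (\<Sum>j\<in>?V. card (A j))"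
    by (rule card_SigmaI) (auto simp: A_def)
  also have "\<dots> = (\<Sum>j\<in>?V. ?l j + (\<Sum>i\<in>{i \<in> ?V. i < j}. ?m i j))"
  proof (intro sum.cong refl)
    fix j assume j: "j \<in> ?V"
    let ?g = "\<lambda>i. of_bool (good_pair n p i j) :: nat" and ?I = "{i \<in> ?V. i < j}"
    have finI: "finite ?I" by (rule finite_subset[of _ ?V]) auto
    \<comment> \<open>The entry \<open>- j\<close> yields the loop at \<open>j\<close>; the entries
      \<open>i\<close> and \<open>- i\<close> with \<open>0 < i < j\<close> yield the edges between
      \<open>i\<close> and \<open>j\<close>.\<close>
    have "A j = ({- j} \<union> (?I \<union> uminus ` ?I)) \<inter> {i. good_pair n p i j}"
    proof (intro equalityI subsetI)
      fix i assume "i \<in> A j"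
      then have i: "i \<noteq> 0" "\<bar>i\<bar> \<le> int n" "- j \<le> i" "i < j" "good_pair n p i j"
        by (simp_all add: A_def signed_points_iff)
      show "i \<in> ({- j} \<union> (?I \<union> uminus ` ?I)) \<inter> {i. good_pair n p i j}"
      proof (cases "0 < i \<or> i = - j")
        case True
        then show ?thesis using i by auto
      next
        case False
        then have "- i \<in> ?I" using i by auto
        then have "i \<in> uminus ` ?I" by (metis image_eqI minus_minus)
        then show ?thesis using i by blast
      qed
    next
      fix i assume "i \<in> ({- j} \<union> (?I \<union> uminus ` ?I)) \<inter> {i. good_pair n p i j}"
      then show "i \<in> A j" using j by (auto simp: A_def signed_points_iff)
    qed
    moreover have "finite ({- j} \<union> (?I \<union> uminus ` ?I))" using finI by blast
    ultimately have "card (A j) = (\<Sum>i\<in>{- j} \<union> (?I \<union> uminus ` ?I). ?g i)"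
      by (simp add: of_bool_def sum.If_cases)
    also have "\<dots> = ?g (- j) + (\<Sum>i\<in>?I \<union> uminus ` ?I. ?g i)"
    proof -
      have "finite (?I \<union> uminus ` ?I)" using finI by blast
      moreover have "- j \<notin> ?I \<union> uminus ` ?I" using j by auto
      ultimately show ?thesis unfolding insert_is_Un[symmetric] by (rule sum.insert)
    qed
    also have "(\<Sum>i\<in>?I \<union> uminus ` ?I. ?g i) = (\<Sum>i\<in>?I. ?g i) + (\<Sum>i\<in>uminus ` ?I. ?g i)"
      by (rule sum.union_disjoint[OF finI finite_imageI[OF finI]]) auto
    also have "(\<Sum>i\<in>uminus ` ?I. ?g i) = (\<Sum>i\<in>?I. ?g (- i))"
      by (simp add: sum.reindex)
    also have "(\<Sum>i\<in>?I. ?g i) + (\<Sum>i\<in>?I. ?g (- i)) = (\<Sum>i\<in>?I. ?m i j)"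
      unfolding sum.distrib[symmetric] using j by (intro sum.cong refl) (simp add: mult_eq_good_pair)
    finally show "card (A j) = ?l j + (\<Sum>i\<in>?I. ?m i j)" using loop_eq_good_pair[OF j] by simp
  qed
  finally have c: "card (good_pairs n p) = (\<Sum>j\<in>?V. ?l j) + (\<Sum>j\<in>?V. \<Sum>i\<in>{i \<in> ?V. i < j}. ?m i j)"
    by (simp only: sum.distrib)
  have "weight (\<lambda>i. i) (\<lambda>i. \<bar>p i\<bar>) (\<lambda>i. 0 < p i) ?V = 2 * (\<Sum>j\<in>?V. ?l j) + (\<Sum>j\<in>?V. \<Sum>i\<in>?V - {j}. ?m j i)"
    unfolding weight_def deg_def sum.distrib by simp
  also have "(\<Sum>j\<in>?V. \<Sum>i\<in>?V - {j}. ?m j i) = 2 * (\<Sum>j\<in>?V. \<Sum>i\<in>{i \<in> ?V. i < j}. ?m i j)"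
    by (rule sum_symmetric_pairs) (simp, rule mult_sym)
  finally show ?thesis using c by simp
qed

end

section \<open>Extremal signed permutations\<close>

lemma signed_permsI:
  assumes "\<And>i. i \<in> signed_points n \<Longrightarrow> p i \<in> signed_points n"
    and "inj_on p (signed_points n)"
    and "\<And>i. i \<notin> signed_points n \<Longrightarrow> p i = i"
    and "\<And>i. i \<in> signed_points n \<Longrightarrow> p (- i) = - p i"
  shows "p \<in> signed_perms n"
proof -
  have "p ` signed_points n = signed_points n"
    using assms(1,2) by (intro endo_inj_surj) auto
  then have "bij_betw p (signed_points n) (signed_points n)" using assms(2) by (simp add: bij_betw_def)
  then have "p permutes signed_points n" using assms(3) by (rule bij_imp_permutes)
  then show ?thesis using assms(4) by (simp add: signed_perms_def)
qed

lemma finite_good_pairs: "finite (good_pairs n p)"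
  by (rule finite_subset[of _ "signed_points n \<times> signed_points n"]) (auto simp: good_pairs_def)

lemma good_pairs_adjacent:
  "0 < i \<Longrightarrow> i < int n \<Longrightarrow> (i, i + 1) \<in> good_pairs n p"
  unfolding good_pairs_def good_pair_def btw_def by (auto simp: signed_points_iff)

text \<open>The window reads n, -(n - 1), n - 2, ...: a decreasing diagonal with alternating
  colours.\<close>

definition zigzag :: "nat \<Rightarrow> int \<Rightarrow> int" where
  "zigzag n i = (if i \<in> signed_points n
     then (if even i then - 1 else 1) * sgn i * (int n + 1 - \<bar>i\<bar>) else i)"

lemma zigzag_uminus: "zigzag n (- i) = - zigzag n i"
  by (simp add: zigzag_def)

lemma zigzag_abs: "i \<in> signed_points n \<Longrightarrow> \<bar>zigzag n i\<bar> = int n + 1 - \<bar>i\<bar>"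
  by (auto simp: zigzag_def signed_points_iff abs_mult)

lemma zigzag_pos: "i \<in> signed_points n \<Longrightarrow> 0 < i \<Longrightarrow> 0 < zigzag n i \<longleftrightarrow> odd i"
  by (auto simp: zigzag_def signed_points_iff)

lemma zigzag_signed_perms: "zigzag n \<in> signed_perms n"
proof (rule signed_permsI)
  show "zigzag n i \<in> signed_points n" if "i \<in> signed_points n" for i
    using zigzag_abs[OF that] that by (auto simp: signed_points_iff)
  show "inj_on (zigzag n) (signed_points n)"
  proof (rule inj_onI)
    fix i j assume ij: "i \<in> signed_points n" "j \<in> signed_points n" "zigzag n i = zigzag n j"
    then have "\<bar>i\<bar> = \<bar>j\<bar>" using zigzag_abs[of i n] zigzag_abs[of j n] by simp
    moreover have "zigzag n i \<noteq> 0" using zigzag_abs[OF ij(1)] ij(1) by (auto simp: signed_points_iff)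
    then have "i \<noteq> - j" using ij(3) zigzag_uminus[of n j] by auto
    ultimately show "i = j" by linarith
  qed
qed (simp_all add: zigzag_def)

lemma card_good_pairs_zigzag:
  assumes n: "2 \<le> n"
  shows "4 * (n - 1) \<le> card (good_pairs n (zigzag n))"
proof -
  let ?p = "zigzag n"
  \<comment> \<open>\<open>A\<close> and \<open>B\<close> are the double edges between neighbours,
    \<open>C\<close> the loops and \<open>D\<close> the single edges between points two
    apart.\<close>
  define A where "A = (\<lambda>i. (i, i + 1)) ` {1..int n - 1}"
  define B where "B = (\<lambda>i. (- i, i + 1)) ` {1..int n - 1}"
  define C where "C = (\<lambda>i. (- i, i)) ` {1..int n}"
  define D where "D = (\<lambda>i. (i, i + 2)) ` {1..int n - 2}"
  have "card A = n - 1" "card B = n - 1" "card C = n" "card D = n - 2"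
    unfolding A_def B_def C_def D_def by (subst card_image; force simp: inj_on_def)+
  moreover have "A \<inter> B = {}" "(A \<union> B) \<inter> C = {}" "(A \<union> B \<union> C) \<inter> D = {}"
    by (auto simp: A_def B_def C_def D_def)
  moreover have "finite A" "finite B" "finite C" "finite D" by (simp_all add: A_def B_def C_def D_def)
  ultimately have card: "card (A \<union> B \<union> C \<union> D) = (n - 1) + (n - 1) + n + (n - 2)"
    by (simp add: card_Un_disjoint)
  have abs: "\<bar>?p k\<bar> = int n + 1 - \<bar>k\<bar>" if "k \<in> signed_points n" for k
    using that by (rule zigzag_abs)
  have "A \<subseteq> good_pairs n ?p"
    unfolding A_def using good_pairs_adjacent by auto
  moreover have "B \<subseteq> good_pairs n ?p"
  proof
    fix x assume "x \<in> B"
    then obtain i where i: "0 < i" "i < int n" "x = (- i, i + 1)" by (auto simp: B_def)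
    have pts: "i \<in> signed_points n" "- i \<in> signed_points n" "i + 1 \<in> signed_points n"
      using i by (auto simp: signed_points_iff)
    have sg: "0 < ?p i \<longleftrightarrow> \<not> 0 < ?p (i + 1)" using zigzag_pos pts i by auto
    have ab: "\<bar>?p (- i)\<bar> = int n + 1 - i" "\<bar>?p (i + 1)\<bar> = int n - i"
      using abs[OF pts(2)] abs[OF pts(3)] i by auto
    have same: "0 < ?p (- i) \<longleftrightarrow> 0 < ?p (i + 1)"
      using sg ab i unfolding zigzag_uminus by linarith
    have "\<not> btw (?p (- i)) 0 (?p (i + 1))" using same ab i unfolding btw_def by linarith
    moreover have "\<not> btw (?p (- i)) (?p k) (?p (i + 1))" if k: "k \<in> signed_points n" "btw (- i) k (i + 1)" for k
    proof -
      \<comment> \<open>Heights decrease with the position, so no position up to \<open>i\<close>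
        has a height strictly between those of \<open>i + 1\<close> and \<open>i\<close>.\<close>
      have "\<bar>k\<bar> \<le> i" using k(2) i by (auto simp: btw_def)
      then have "\<bar>?p k\<bar> \<ge> int n + 1 - i" using abs[OF k(1)] by simp
      then show ?thesis using same ab unfolding btw_def by linarith
    qed
    ultimately show "x \<in> good_pairs n ?p" using pts i by (auto simp: good_pairs_def good_pair_def)
  qed
  moreover have "C \<subseteq> good_pairs n ?p"
  proof
    fix x assume "x \<in> C"
    then obtain i where i: "0 < i" "i \<le> int n" "x = (- i, i)" by (auto simp: C_def)
    have pts: "i \<in> signed_points n" "- i \<in> signed_points n"
      using i by (auto simp: signed_points_iff)
    have "\<not> btw (?p (- i)) (?p k) (?p i)" if k: "k \<in> signed_points n" "btw (- i) k i" for k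
    proof -
      have "\<bar>k\<bar> < i" using k(2) i by (auto simp: btw_def)
      then have "\<bar>?p k\<bar> > \<bar>?p i\<bar>" using abs[OF k(1)] abs[OF pts(1)] i by simp
      then show ?thesis unfolding btw_def zigzag_uminus by linarith
    qed
    then show "x \<in> good_pairs n ?p" using pts i by (auto simp: good_pairs_def good_pair_def)
  qed
  moreover have "D \<subseteq> good_pairs n ?p"
  proof
    fix x assume "x \<in> D"
    then obtain i where i: "0 < i" "i + 2 \<le> int n" "x = (i, i + 2)" by (auto simp: D_def)
    have pts: "i \<in> signed_points n" "i + 1 \<in> signed_points n" "i + 2 \<in> signed_points n"
      using i by (auto simp: signed_points_iff)
    have "0 < ?p i \<longleftrightarrow> \<not> 0 < ?p (i + 1)" "0 < ?p i \<longleftrightarrow> 0 < ?p (i + 2)"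
      using zigzag_pos[OF pts(1)] zigzag_pos[OF pts(2)] zigzag_pos[OF pts(3)] i by auto
    moreover have "?p i \<noteq> 0" "?p (i + 1) \<noteq> 0" "?p (i + 2) \<noteq> 0"
      using abs[OF pts(1)] abs[OF pts(2)] abs[OF pts(3)] i by auto
    ultimately have "\<not> btw (?p i) (?p (i + 1)) (?p (i + 2))" unfolding btw_def by linarith
    moreover have "k = i + 1" if "btw i k (i + 2)" for k using that by (auto simp: btw_def)
    moreover have "\<not> btw i 0 (i + 2)" using i by (auto simp: btw_def)
    ultimately show "x \<in> good_pairs n ?p" using pts i by (auto simp: good_pairs_def good_pair_def)
  qed
  ultimately have "A \<union> B \<union> C \<union> D \<subseteq> good_pairs n ?p" by blast
  then have "card (A \<union> B \<union> C \<union> D) \<le> card (good_pairs n ?p)" by (rule card_mono[OF finite_good_pairs])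
  then show ?thesis using card n by simp
qed

text \<open>The window reads -1, ..., -b, n, n - 1, ..., b + 1: an increasing diagonal of one colour
  and, above and to the right of it, a decreasing diagonal of the other.\<close>

definition two_blocks :: "nat \<Rightarrow> nat \<Rightarrow> int \<Rightarrow> int" where
  "two_blocks n b i = (if \<bar>i\<bar> \<le> int b then - i
     else if \<bar>i\<bar> \<le> int n then sgn i * (int n + int b + 1) - i else i)"

lemma two_blocks_signed_perms:
  assumes "b \<le> n"
  shows "two_blocks n b \<in> signed_perms n"
proof (rule signed_permsI)
  have invol: "two_blocks n b (two_blocks n b i) = i" if "i \<in> signed_points n" for i
    using that assms by (cases "0 < i") (auto simp: two_blocks_def signed_points_iff sgn_if)
  then show "inj_on (two_blocks n b) (signed_points n)" by (metis inj_onI)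
  show "two_blocks n b i \<in> signed_points n" if "i \<in> signed_points n" for i
    using that assms by (cases "0 < i") (auto simp: two_blocks_def signed_points_iff sgn_if)
  show "two_blocks n b i = i" if "i \<notin> signed_points n" for i
    using that assms by (auto simp: two_blocks_def signed_points_iff)
  show "two_blocks n b (- i) = - two_blocks n b i" for i
    by (simp add: two_blocks_def)
qed

lemma card_good_pairs_two_blocks:
  assumes b: "0 < b" "b < n"
  shows "2 * (b * (n - b)) + n - 1 \<le> card (good_pairs n (two_blocks n b))"
proof -
  let ?p = "two_blocks n b" and ?I = "{1..int b}" and ?J = "{int b + 1..int n}"
  \<comment> \<open>\<open>A\<close> and \<open>B\<close> are the two edges between points of
    different blocks, \<open>C\<close> the neighbours within a block; \<open>int b\<close> is
    omitted because its pair already lies in \<open>A\<close>. The loop at the first point,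
    \<open>(- 1, 1)\<close>, is added below.\<close>
  define A where "A = ?I \<times> ?J"
  define B where "B = (\<lambda>(i, j). (- i, j)) ` (?I \<times> ?J)"
  define C where "C = (\<lambda>i. (i, i + 1)) ` ({1..int n - 1} - {int b})"
  have cA: "card A = b * (n - b)" using b by (simp add: A_def)
  have cB: "card B = b * (n - b)" unfolding B_def using b by (subst card_image) (auto simp: inj_on_def)
  have cC: "card C = n - 2" unfolding C_def using b by (subst card_image) (auto simp: inj_on_def card_Diff_singleton)
  have fin: "finite A" "finite B" "finite C" by (simp_all add: A_def B_def C_def)
  have dis: "A \<inter> B = {}" "(A \<union> B) \<inter> C = {}" "(- 1, 1) \<notin> A \<union> B \<union> C"
    by (auto simp: A_def B_def C_def)
  have card: "card (insert (- 1, 1) (A \<union> B \<union> C)) = Suc (b * (n - b) + b * (n - b) + (n - 2))"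
    using fin dis cA cB cC by (simp add: card_Un_disjoint)
  have pI: "?p k = - k" if "- int b \<le> k" "k \<le> int b" for k
    using that by (auto simp: two_blocks_def)
  have pJ: "?p k = int n + int b + 1 - k" if "int b < k" "k \<le> int n" for k
    using that b by (simp add: two_blocks_def)
  have "A \<subseteq> good_pairs n ?p"
  proof
    fix x assume "x \<in> A"
    then obtain i j where x: "x = (i, j)" and ij: "1 \<le> i" "i \<le> int b" "int b < j" "j \<le> int n"
      by (auto simp: A_def)
    have pts: "i \<in> signed_points n" "j \<in> signed_points n" using ij b by (auto simp: signed_points_iff)
    have v: "?p i = - i" "?p j = int n + int b + 1 - j" using pI[of i] pJ[of j] ij by auto
    have "\<not> btw (?p i) (?p k) (?p j)" if "btw i k j" for k
    proof -
      have k: "i < k" "k < j" using that ij by (auto simp: btw_def)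
      show ?thesis
      proof (cases "k \<le> int b")
        case True
        then have "?p k = - k" using k ij by (intro pI) auto
        then show ?thesis unfolding v btw_def using k ij by auto
      next
        case False
        then have "?p k = int n + int b + 1 - k" using k ij by (intro pJ) auto
        then show ?thesis unfolding v btw_def using k ij by auto
      qed
    qed
    moreover have "\<not> btw i 0 j" using ij by (auto simp: btw_def)
    ultimately show "x \<in> good_pairs n ?p" using pts ij x by (auto simp: good_pairs_def good_pair_def)
  qed
  moreover have "B \<subseteq> good_pairs n ?p"
  proof
    fix x assume "x \<in> B"
    then obtain i j where x: "x = (- i, j)" and ij: "1 \<le> i" "i \<le> int b" "int b < j" "j \<le> int n"
      by (auto simp: B_def)
    have pts: "- i \<in> signed_points n" "j \<in> signed_points n" using ij b by (auto simp: signed_points_iff)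
    have v: "?p (- i) = i" "?p j = int n + int b + 1 - j" using pI[of "- i"] pJ[of j] ij by auto
    have "\<not> btw (?p (- i)) (?p k) (?p j)" if "btw (- i) k j" for k
    proof -
      have k: "- i < k" "k < j" using that ij by (auto simp: btw_def)
      show ?thesis
      proof (cases "k \<le> int b")
        case True
        then have "?p k = - k" using k ij by (intro pI) auto
        then show ?thesis unfolding v btw_def using k ij by auto
      next
        case False
        then have "?p k = int n + int b + 1 - k" using k ij by (intro pJ) auto
        then show ?thesis unfolding v btw_def using k ij by auto
      qed
    qed
    moreover have "\<not> btw (?p (- i)) 0 (?p j)" unfolding v btw_def using ij by auto
    ultimately show "x \<in> good_pairs n ?p" using pts ij x by (auto simp: good_pairs_def good_pair_def)
  qed
  moreover have "C \<subseteq> good_pairs n ?p"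
    unfolding C_def using good_pairs_adjacent by auto
  moreover have "(- 1, 1) \<in> good_pairs n ?p"
    using b by (auto simp: good_pairs_def good_pair_def btw_def signed_points_iff)
  ultimately have "insert (- 1, 1) (A \<union> B \<union> C) \<subseteq> good_pairs n ?p" by blast
  then have "card (insert (- 1, 1) (A \<union> B \<union> C)) \<le> card (good_pairs n ?p)"
    by (rule card_mono[OF finite_good_pairs])
  then show ?thesis using card b by simp
qed

section \<open>The maximum\<close>

lemma Max_total_degree:
  assumes n: "2 \<le> n"
    and lower: "w \<in> signed_perms n" "bound n \<le> total_degree n w"
  shows "Max {total_degree n p | p. p \<in> signed_perms n} = bound n"
proof -
  have upper: "total_degree n p \<le> bound n" if p: "p \<in> signed_perms n" for p
  proof -
    have "inj_on (\<lambda>i. \<bar>p i\<bar>) {1..int n}"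
      by (rule inj_onI) (rule p_abs_inj[OF p], auto)
    then have "weight (\<lambda>i. i) (\<lambda>i. \<bar>p i\<bar>) (\<lambda>i. 0 < p i) {1..int n} \<le> 2 * bound (card {1..int n})"
      using n by (intro weight_le) auto
    then show ?thesis using card_good_pairs[OF p] total_degree_eq[OF p] by simp
  qed
  have "bound n = total_degree n w" using upper[OF lower(1)] lower(2) by simp
  then have "bound n \<in> {total_degree n p | p. p \<in> signed_perms n}" using lower(1) by blast
  moreover have "finite {total_degree n p | p. p \<in> signed_perms n}"
    using finite_signed_perms by simp
  ultimately show ?thesis using upper by (intro Max_eqI) auto
qed

theorem mainTheorem10:
  fixes n :: nat
  shows "(2 \<le> n \<and> n \<le> 5 \<longrightarrow>
            Max {total_degree n p | p. p \<in> signed_perms n} = 4 * (n - 1)) \<and>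
         (5 \<le> n \<longrightarrow>
            Max {total_degree n p | p. p \<in> signed_perms n} = n\<^sup>2 div 2 + n - 1)"
proof (intro conjI impI)
  assume n: "2 \<le> n \<and> n \<le> 5"
  then have "bound n \<le> total_degree n (zigzag n)"
    using card_good_pairs_zigzag[of n] total_degree_eq[OF zigzag_signed_perms] by (simp add: bound_def)
  then show "Max {total_degree n p | p. p \<in> signed_perms n} = 4 * (n - 1)"
    using Max_total_degree[OF _ zigzag_signed_perms] n by (simp add: bound_def)
next
  assume n: "5 \<le> n"
  then have b: "bound n = n\<^sup>2 div 2 + n - 1" by (cases "n = 5") (simp_all add: bound_def)
  \<comment> \<open>The product \<open>b * (n - b)\<close> is largest for nearly equal blocks, where
    its double is \<open>n\<^sup>2 div 2\<close>.\<close>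
  define b where "b = n div 2"
  have bn: "0 < b" "b < n" "b \<le> n" using n by (auto simp: b_def)
  have "n\<^sup>2 div 2 = 2 * (b * (n - b))"
  proof (cases "even n")
    case True
    then obtain m where "n = 2 * m" by blast
    then show ?thesis by (simp add: b_def power2_eq_square)
  next
    case False
    then obtain m where m: "n = 2 * m + 1" by (rule oddE)
    then have "n\<^sup>2 = 2 * (2 * (m * (m + 1))) + 1" by (simp add: power2_eq_square algebra_simps)
    then show ?thesis by (simp add: b_def m)
  qed
  then have "bound n \<le> total_degree n (two_blocks n b)"
    using card_good_pairs_two_blocks[OF bn(1,2)] total_degree_eq[OF two_blocks_signed_perms[OF bn(3)]]
    unfolding b by simp
  then show "Max {total_degree n p | p. p \<in> signed_perms n} = n\<^sup>2 div 2 + n - 1"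
    using Max_total_degree[OF _ two_blocks_signed_perms[OF bn(3)]] n unfolding b by simp
qed

end
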